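(* For $\lambda>0$ let $d\mu_\lambda=\frac{e^{-|x|^2/(2\lambda^2)}}{\int_{\mathbb{R}^N}e^{-|x|^2/(2\lambda^2)}dx}dx$ on $\mathbb{R}^N$. For $\lambda>0$ and $u\in X_{\lambda,0}$, $$\int_{\mathbb{R}^N}|\nabla u|^2d\mu_\lambda\ge\frac1{\lambda^2}\inf_{c\in\mathbb{R},\,\vec d\in\mathbb{R}^N}\int_{\mathbb{R}^N}\left(|u-c|^2+|u-c-\vec d\cdot x|^2\right)d\mu_\lambda.$$ Moreover, equality is attained by some non-linear functions.
   Context: $X_{\lambda,0}$ is the completion of $C_0^\infty(\mathbb{R}^N)$ under the norm $\left(\int_{\mathbb{R}^N}|u|^2d\mu_\lambda\right)^{1/2}+\left(\int_{\mathbb{R}^N}|\nabla u|^2d\mu_\lambda\right)^{1/2}$. *)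

theory Defs
  imports "HOL-Analysis.Analysis"
begin

definition gauss_density :: "real \<Rightarrow> 'a::euclidean_space \<Rightarrow> real" where
  "gauss_density lam x = exp (- (norm x)\<^sup>2 / (2 * lam\<^sup>2))"

definition gauss_mu :: "real \<Rightarrow> 'a::euclidean_space measure" where
  "gauss_mu lam = density lborel
     (\<lambda>x. ennreal (gauss_density lam x / (\<integral>y. gauss_density lam (y::'a) \<partial>lborel)))"

coinductive smooth :: "('a::euclidean_space \<Rightarrow> real) \<Rightarrow> bool" where
  "(\<forall>x. f differentiable (at x)) \<Longrightarrow>
   (\<forall>b\<in>Basis. smooth (\<lambda>x. frechet_derivative f (at x) b)) \<Longrightarrow> smooth f"

definition test_fun :: "('a::euclidean_space \<Rightarrow> real) \<Rightarrow> bool" where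
  "test_fun f \<longleftrightarrow> smooth f \<and> compact (closure {x. f x \<noteq> 0})"

definition grad :: "('a::euclidean_space \<Rightarrow> real) \<Rightarrow> 'a \<Rightarrow> 'a" where
  "grad f x = (\<Sum>b\<in>Basis. frechet_derivative f (at x) b *\<^sub>R b)"

text \<open>Membership in X_{lambda,0}: u (with gradient g) is the limit, in the norm
  ||u||_{L^2(mu)} + ||grad u||_{L^2(mu)}, of a sequence of C_0^infinity functions.\<close>
definition X_lam0 :: "real \<Rightarrow> ('a::euclidean_space \<Rightarrow> real) \<Rightarrow> ('a \<Rightarrow> 'a) \<Rightarrow> bool" where
  "X_lam0 lam u g \<longleftrightarrow> u \<in> borel_measurable lborel \<and> g \<in> borel_measurable lborel \<and>
     (\<exists>\<phi>::nat \<Rightarrow> 'a \<Rightarrow> real. (\<forall>n. test_fun (\<phi> n)) \<and>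
        (\<lambda>n. \<integral>\<^sup>+ x. ennreal ((\<phi> n x - u x)\<^sup>2) \<partial>gauss_mu lam) \<longlonglongrightarrow> 0 \<and>
        (\<lambda>n. \<integral>\<^sup>+ x. ennreal ((norm (grad (\<phi> n) x - g x))\<^sup>2) \<partial>gauss_mu lam) \<longlonglongrightarrow> 0)"

definition dirichlet :: "real \<Rightarrow> ('a::euclidean_space \<Rightarrow> 'a) \<Rightarrow> ennreal" where
  "dirichlet lam g = (\<integral>\<^sup>+ x. ennreal ((norm (g x))\<^sup>2) \<partial>gauss_mu lam)"

definition rhs_inf :: "real \<Rightarrow> ('a::euclidean_space \<Rightarrow> real) \<Rightarrow> ennreal" where
  "rhs_inf lam u = ennreal (1 / lam\<^sup>2) *
     (INF cd \<in> (UNIV :: (real \<times> 'a) set).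
        \<integral>\<^sup>+ x. ennreal ((u x - fst cd)\<^sup>2 + (u x - fst cd - snd cd \<bullet> x)\<^sup>2) \<partial>gauss_mu lam)"

end

(* Writing u = sum_k u_k in Hermite components, the left side is sum_k k |u_k|^2 / lam^2 and the right
   side is sum_{k >= 1} |u_k|^2 / lam^2 + sum_{k >= 2} |u_k|^2 / lam^2, so equality holds for quadratics.
   To avoid completeness of the Hermite system, let P_t be the Ornstein-Uhlenbeck operators (Mehler kernel),
   P_s P_t = P_{st}, and let h be a test function f minus its projection onto the affine functions.
   Cauchy-Schwarz gives <h, P_t h>^2 <= |h|^2 <h, P_{t^2} h>; iterating this and using that
   <h, P_s h> = O(s^2) as s -> 0 yields <h, P_t h> <= t^2 |h|^2.  On the other hand
   2 (|f|^2 - <f, P_t f>) is the mean square increment of f along the correlated pair (X, tX + sqrt(1-t^2) W),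
   which divided by 1 - t^2 tends to lam^2 int |grad f|^2 as t -> 1. *)
theory Submission
  imports Defs "HOL-Probability.Distributions"
begin

section \<open>The Gaussian measure\<close>

text \<open>The iteration stands in for the spectral statement that P_t contracts by t^2 off the
  affine functions. What it needs near s = 0 shapes the setting: the Mehler kernel equals 1 + s x.z
  / lam^2 + O(s^2) uniformly only on bounded sets, and h may be unbounded, so the expansion must be
  tested against f, which has bounded support. The weights in the result come from the two
  eigenvalue gaps. For t < 1 one gets |f|^2 - <f, P_t f> >= (1 - t^2) |h|^2 + (1 - t) lam^2
  |slope|^2. Dividing by 1 - t^2 and letting t -> 1, the linear part keeps half its weight; after
  doubling, the lower bound is 2 |h|^2 + lam^2 |slope|^2, which is |f - mean|^2 + |h|^2 by
  Pythagoras.\<close>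

definition gauss_pdf :: "real \<Rightarrow> 'a::euclidean_space \<Rightarrow> real" where
  "gauss_pdf lam x = (\<Prod>b\<in>Basis. normal_density 0 lam (x \<bullet> b))"

text \<open>The product form serves coordinatewise integration; the closed form can be merged with
  the exponent of the Mehler kernel.\<close>

lemma gauss_pdf_eq:
  "gauss_pdf lam (x::'a::euclidean_space) = (1 / sqrt (2 * pi * lam\<^sup>2)) ^ DIM('a) * gauss_density lam x"
proof -
  have n: "(norm x)\<^sup>2 = (\<Sum>b\<in>Basis. (x \<bullet> b)\<^sup>2)"
    unfolding power2_norm_eq_inner by (subst euclidean_inner) (simp add: power2_eq_square)
  have "gauss_pdf lam x = (\<Prod>b\<in>(Basis::'a set). 1 / sqrt (2 * pi * lam\<^sup>2)) *
      (\<Prod>b\<in>Basis. exp (- (x \<bullet> b)\<^sup>2 / (2 * lam\<^sup>2)))"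
    unfolding gauss_pdf_def normal_density_def by (subst prod.distrib) simp
  also have "(\<Prod>b\<in>Basis. exp (- (x \<bullet> b)\<^sup>2 / (2 * lam\<^sup>2))) = gauss_density lam x"
    unfolding gauss_density_def n
    by (simp add: exp_sum[symmetric] sum_divide_distrib sum_negf)
  finally show ?thesis by simp
qed

lemma gauss_pdf_nonneg[simp]: "0 \<le> gauss_pdf lam x"
  unfolding gauss_pdf_def by (intro prod_nonneg) auto

lemma borel_measurable_gauss_pdf[measurable]: "gauss_pdf lam \<in> borel_measurable borel"
  unfolding gauss_pdf_def[abs_def] by measurable

lemma integral_lborel_affine:
  fixes F :: "'a::euclidean_space \<Rightarrow> real"
  assumes [measurable]: "F \<in> borel_measurable borel" and s: "s > 0"
  shows "(\<integral>x. F x \<partial>lborel) = s ^ DIM('a) * (\<integral>w. F (m + s *\<^sub>R w) \<partial>lborel)"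
proof -
  have "(\<integral>x. F x \<partial>lborel) = (\<integral>x. F x \<partial>density (distr lborel borel (\<lambda>x::'a. m + s *\<^sub>R x)) (\<lambda>_. ennreal (s^DIM('a))))"
    using lborel_affine[of s m] s by simp
  also have "\<dots> = s ^ DIM('a) * (\<integral>w. F (m + s *\<^sub>R w) \<partial>lborel)"
    using s by (subst integral_density) (auto simp: integral_distr)
  finally show ?thesis .
qed

locale gaussian =
  fixes lam :: real
  assumes lam: "lam > 0"
begin

lemma has_integral_gauss_pdf:
  "has_bochner_integral lborel (gauss_pdf lam :: 'a::euclidean_space \<Rightarrow> real) 1"
proof (rule has_bochner_integral_nn_integral)
  have 1: "(\<integral>\<^sup>+ x. ennreal (normal_density 0 lam x) \<partial>lborel) = 1"
    using lam by (simp add: nn_integral_eq_integral)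
  have "(\<integral>\<^sup>+ x. ennreal (gauss_pdf lam (x::'a)) \<partial>lborel)
      = (\<integral>\<^sup>+ x. (\<Prod>b\<in>(Basis::'a set). ennreal (normal_density 0 lam (x \<bullet> b))) \<partial>lborel)"
    unfolding gauss_pdf_def by (simp add: prod_ennreal)
  also have "\<dots> = 1"
    by (subst nn_integral_lborel_prod) (auto simp: 1)
  finally show "(\<integral>\<^sup>+ x. ennreal (gauss_pdf lam (x::'a)) \<partial>lborel) = ennreal 1" by simp
qed auto

lemma integral_gauss_density:
  "(\<integral>y. gauss_density lam (y::'a::euclidean_space) \<partial>lborel) = sqrt (2 * pi * lam\<^sup>2) ^ DIM('a)"
proof -
  have "1 = (\<integral>y. gauss_pdf lam (y::'a) \<partial>lborel)"
    using has_integral_gauss_pdf has_bochner_integral_integral_eq by metis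
  also have "\<dots> = (1 / sqrt (2 * pi * lam\<^sup>2)) ^ DIM('a) * (\<integral>y. gauss_density lam (y::'a) \<partial>lborel)"
    unfolding gauss_pdf_eq by simp
  finally show ?thesis using lam by (simp add: field_simps)
qed

lemma gauss_mu_eq:
  "gauss_mu lam = density lborel (\<lambda>x::'a::euclidean_space. ennreal (gauss_pdf lam x))"
  unfolding gauss_mu_def gauss_pdf_eq integral_gauss_density
  by (simp add: power_one_over field_simps)

lemma sets_gauss_mu[simp, measurable_cong]: "sets (gauss_mu lam) = sets borel"
  by (simp add: gauss_mu_eq)

lemma space_gauss_mu[simp]: "space (gauss_mu lam) = UNIV"
  by (simp add: gauss_mu_eq)

lemma prob_space_gauss_mu: "prob_space (gauss_mu lam :: 'a::euclidean_space measure)"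
proof
  show "emeasure (gauss_mu lam) (space (gauss_mu lam :: 'a measure)) = 1"
    using has_integral_gauss_pdf[where 'a='a]
    by (simp add: gauss_mu_eq emeasure_density has_bochner_integral_iff nn_integral_eq_integral)
qed

lemma integral_gauss_mu:
  fixes F :: "'a::euclidean_space \<Rightarrow> real"
  assumes [measurable]: "F \<in> borel_measurable borel"
  shows "(\<integral>x. F x \<partial>gauss_mu lam) = (\<integral>x. gauss_pdf lam x * F x \<partial>lborel)"
  unfolding gauss_mu_eq by (subst integral_density) auto

lemma has_integral_gauss_mu_even:
  fixes b :: "'a::euclidean_space"
  assumes b: "b \<in> Basis"
  shows "has_bochner_integral (gauss_mu lam) (\<lambda>x. (x \<bullet> b) ^ (2*k)) (fact (2 * k) / ((2 / lam\<^sup>2)^k * fact k))"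
proof (rule has_bochner_integral_nn_integral)
  \<comment> \<open>The factor at b carries the whole moment and the others stay normal densities,
    so the product of one-dimensional integrals collapses to a single moment.\<close>
  define F where "F a y = (if a = b then normal_density 0 lam y * y ^ (2*k) else normal_density 0 lam y)"
    for a::'a and y
  have 1: "(\<integral>\<^sup>+ x. ennreal (normal_density 0 lam x) \<partial>lborel) = 1"
    using lam by (simp add: nn_integral_eq_integral)
  have 2: "(\<integral>\<^sup>+ x. ennreal (normal_density 0 lam x * x^(2*k)) \<partial>lborel) = ennreal (fact (2 * k) / ((2 / lam\<^sup>2)^k * fact k))"
    using normal_moment_even[OF lam, of 0 k]
    by (subst nn_integral_eq_integral) (auto simp: has_bochner_integral_iff zero_le_even_power)
  have "(\<integral>\<^sup>+ x. ennreal ((x \<bullet> b) ^ (2*k)) \<partial>gauss_mu lam) =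
     (\<integral>\<^sup>+ x. (\<Prod>a\<in>Basis. ennreal (F a (x \<bullet> a))) \<partial>lborel)"
    unfolding gauss_mu_eq
  proof (subst nn_integral_density; (intro nn_integral_cong)?)
    fix x :: 'a
    have "(\<Prod>a\<in>Basis. F a (x \<bullet> a)) = F b (x \<bullet> b) * (\<Prod>a\<in>Basis - {b}. F a (x \<bullet> a))"
      using b by (simp add: prod.remove)
    also have "\<dots> = (x \<bullet> b)^(2*k) * (normal_density 0 lam (x \<bullet> b) * (\<Prod>a\<in>Basis - {b}. normal_density 0 lam (x \<bullet> a)))"
      by (simp add: F_def)
    also have "\<dots> = (x \<bullet> b)^(2*k) * gauss_pdf lam x"
      unfolding gauss_pdf_def using b by (simp add: prod.remove)
    finally show "ennreal (gauss_pdf lam x) * ennreal ((x \<bullet> b) ^ (2*k)) = (\<Prod>a\<in>Basis. ennreal (F a (x \<bullet> a)))"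
      by (subst prod_ennreal) (auto simp: F_def ennreal_mult' mult.commute zero_le_even_power)
  qed auto
  also have "\<dots> = (\<Prod>a\<in>Basis. \<integral>\<^sup>+ x. F a x \<partial>lborel)"
    by (subst nn_integral_lborel_prod) (auto simp: F_def zero_le_even_power)
  also have "\<dots> = (\<integral>\<^sup>+ x. F b x \<partial>lborel) * (\<Prod>a\<in>Basis-{b}. \<integral>\<^sup>+ x. F a x \<partial>lborel)"
    using b by (simp add: prod.remove)
  also have "\<dots> = ennreal (fact (2 * k) / ((2 / lam\<^sup>2)^k * fact k))"
    by (simp add: F_def 1 2)
  finally show "(\<integral>\<^sup>+ x. ennreal ((x \<bullet> b) ^ (2*k)) \<partial>gauss_mu lam) = ennreal (fact (2 * k) / ((2 / lam\<^sup>2)^k * fact k))" .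
qed (auto simp: zero_le_even_power)

text \<open>Lebesgue measure and density are both unchanged by sign changes of coordinates.
  Reversing all coordinates will remove the means, reversing a single one the off-diagonal
  covariances.\<close>

lemma distr_gauss_mu_reflect:
  fixes c :: "'a::euclidean_space \<Rightarrow> real"
  assumes c: "\<And>b. b \<in> Basis \<Longrightarrow> \<bar>c b\<bar> = 1"
  shows "distr (gauss_mu lam) borel (\<lambda>x. \<Sum>b\<in>Basis. (c b * (x \<bullet> b)) *\<^sub>R b) = gauss_mu lam"
proof -
  let ?T = "\<lambda>x::'a. \<Sum>b\<in>Basis. (c b * (x \<bullet> b)) *\<^sub>R b"
  have c0: "b \<in> Basis \<Longrightarrow> c b \<noteq> 0" for b using c[of b] by auto
  have d: "distr lborel borel ?T = lborel"
    using lborel_affine_euclidean[of c 0] c0 c by (simp add: density_1)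
  have p: "gauss_pdf lam (?T x) = gauss_pdf lam x" for x
    unfolding gauss_pdf_def
  proof (intro prod.cong refl)
    fix b :: 'a assume b: "b \<in> Basis"
    have "(c b)\<^sup>2 = 1" using c[OF b] by (metis power2_abs one_power2)
    then show "normal_density 0 lam (?T x \<bullet> b) = normal_density 0 lam (x \<bullet> b)"
      using b by (simp add: inner_sum_left inner_Basis normal_density_def power_mult_distrib if_distrib cong: if_cong)
  qed
  have "distr (gauss_mu lam) borel ?T = distr (density lborel (\<lambda>x. ennreal (gauss_pdf lam (?T x)))) borel ?T"
    unfolding p gauss_mu_eq ..
  also have "\<dots> = density (distr lborel borel ?T) (\<lambda>x. ennreal (gauss_pdf lam x))"
    by (subst density_distr) auto
  finally show ?thesis unfolding d gauss_mu_eq .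
qed

lemma distr_gauss_mu_uminus: "distr (gauss_mu lam) borel uminus = (gauss_mu lam :: 'a::euclidean_space measure)"
proof -
  have "(\<Sum>b\<in>Basis. (-1 * (x \<bullet> b)) *\<^sub>R b) = - x" for x :: 'a
    by (simp add: sum_negf euclidean_representation)
  then show ?thesis
    using distr_gauss_mu_reflect[of "\<lambda>_::'a. -1"] by (simp add: fun_Compl_def)
qed

lemma integral_gauss_mu_uminus:
  fixes F :: "'a::euclidean_space \<Rightarrow> real"
  assumes [measurable]: "F \<in> borel_measurable borel"
  shows "(\<integral>x. F (- x) \<partial>gauss_mu lam) = (\<integral>x. F x \<partial>gauss_mu lam)"
  by (subst (2) distr_gauss_mu_uminus[symmetric]) (subst integral_distr, auto)

lemma integrable_gauss_mu_bounded:
  fixes F :: "'a::euclidean_space \<Rightarrow> real"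
  assumes [measurable]: "F \<in> borel_measurable borel" and "\<And>x. \<bar>F x\<bar> \<le> B"
  shows "integrable (gauss_mu lam) F"
proof -
  interpret prob_space "gauss_mu lam :: 'a measure" by (rule prob_space_gauss_mu)
  show ?thesis using assms(2) by (intro integrable_const_bound[of _ B]) auto
qed

lemma integrable_inner_mult:
  fixes v w :: "'a::euclidean_space"
  shows "integrable (gauss_mu lam) (\<lambda>x. (x \<bullet> v) * (x \<bullet> w))"
proof -
  have 1: "integrable (gauss_mu lam) (\<lambda>x. (x \<bullet> b)\<^sup>2)" if "b \<in> Basis" for b::'a
    using has_integral_gauss_mu_even[OF that, of 1] by (simp add: has_bochner_integral_iff)
  have n: "(norm x)\<^sup>2 = (\<Sum>b\<in>Basis. (x \<bullet> b)\<^sup>2)" for x::'a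
    unfolding power2_norm_eq_inner by (subst euclidean_inner) (simp add: power2_eq_square)
  have 2: "integrable (gauss_mu lam) (\<lambda>x::'a. (norm x)\<^sup>2)"
    unfolding n using 1 by simp
  have "integrable (gauss_mu lam) (\<lambda>x::'a. (norm v * norm w) * (norm x)\<^sup>2)"
    using 2 by auto
  then show ?thesis
  proof (rule Bochner_Integration.integrable_bound)
    show "AE x in gauss_mu lam. norm ((x \<bullet> v) * (x \<bullet> w)) \<le> norm (norm v * norm w * (norm x)\<^sup>2)"
    proof (intro AE_I2)
      fix x :: 'a
      have "\<bar>x \<bullet> v\<bar> * \<bar>x \<bullet> w\<bar> \<le> (norm x * norm v) * (norm x * norm w)"
        by (intro mult_mono Cauchy_Schwarz_ineq2) auto
      then show "norm ((x \<bullet> v) * (x \<bullet> w)) \<le> norm (norm v * norm w * (norm x)\<^sup>2)"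
        by (simp add: abs_mult power2_eq_square mult_ac)
    qed
  qed auto
qed

lemma integrable_norm_sq: "integrable (gauss_mu lam) (\<lambda>x::'a::euclidean_space. (norm x)\<^sup>2)"
proof -
  have "(norm x)\<^sup>2 = (\<Sum>b\<in>Basis. (x \<bullet> b) * (x \<bullet> b))" for x::'a
    unfolding power2_norm_eq_inner by (subst euclidean_inner) simp
  then show ?thesis by (simp add: integrable_inner_mult)
qed

lemma integrable_norm: "integrable (gauss_mu lam) (\<lambda>x::'a::euclidean_space. norm x)"
proof -
  interpret prob_space "gauss_mu lam :: 'a measure" by (rule prob_space_gauss_mu)
  show ?thesis by (rule square_integrable_imp_integrable) (use integrable_norm_sq in auto)
qed

lemma integrable_inner: "integrable (gauss_mu lam) (\<lambda>x::'a::euclidean_space. x \<bullet> v)"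
proof (rule Bochner_Integration.integrable_bound[where f="\<lambda>x. norm v * norm x"])
  show "AE x in gauss_mu lam. norm (x \<bullet> v) \<le> norm (norm v * norm (x::'a))"
    by (intro AE_I2) (simp add: Cauchy_Schwarz_ineq2 mult.commute)
qed (auto intro: integrable_norm)

lemma integral_inner: "(\<integral>x. x \<bullet> v \<partial>gauss_mu lam) = (0 :: real)" for v :: "'a::euclidean_space"
  using integral_gauss_mu_uminus[of "\<lambda>x. x \<bullet> v"] by simp

lemma integral_inner_Basis:
  fixes b c :: "'a::euclidean_space"
  assumes b: "b \<in> Basis" and c: "c \<in> Basis"
  shows "(\<integral>x. (x \<bullet> b) * (x \<bullet> c) \<partial>gauss_mu lam) = (if b = c then lam\<^sup>2 else 0)"
proof (cases "b = c")
  case True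
  then show ?thesis using has_integral_gauss_mu_even[OF b, of 1] 
    by (simp add: has_bochner_integral_iff power2_eq_square fact_numeral)
next
  case False
  \<comment> \<open>Reversing coordinate b alone preserves the measure but changes the sign of the
    product, as c is a different coordinate.\<close>
  define s where "s a = (if a = b then -1 else 1 :: real)" for a
  have 1: "(\<Sum>a\<in>Basis. (s a * (x \<bullet> a)) *\<^sub>R a) \<bullet> e = s e * (x \<bullet> e)" if "e \<in> Basis" for x e :: 'a
    using that by (simp add: inner_sum_left inner_Basis if_distrib cong: if_cong)
  have "(\<integral>x. (x \<bullet> b) * (x \<bullet> c) \<partial>gauss_mu lam) =
     (\<integral>x. (x \<bullet> b) * (x \<bullet> c) \<partial>distr (gauss_mu lam) borel (\<lambda>x. \<Sum>a\<in>Basis. (s a * (x \<bullet> a)) *\<^sub>R a))"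
    by (subst distr_gauss_mu_reflect) (auto simp: s_def)
  also have "\<dots> = - (\<integral>x. (x \<bullet> b) * (x \<bullet> c) \<partial>gauss_mu lam)"
    using False b c by (subst integral_distr) (auto simp: 1 s_def)
  finally show ?thesis using False by simp
qed

lemma integral_inner_mult:
  fixes v w :: "'a::euclidean_space"
  shows "(\<integral>x. (x \<bullet> v) * (x \<bullet> w) \<partial>gauss_mu lam) = lam\<^sup>2 * (v \<bullet> w)"
proof -
  have "(x \<bullet> v) * (x \<bullet> w) = (\<Sum>b\<in>Basis. \<Sum>c\<in>Basis. ((v \<bullet> b) * (w \<bullet> c)) * ((x \<bullet> b) * (x \<bullet> c)))" for x :: 'a
    by (subst (1 2) euclidean_inner) (simp add: sum_product mult_ac)
  then have "(\<integral>x. (x \<bullet> v) * (x \<bullet> w) \<partial>gauss_mu lam) =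
    (\<Sum>b\<in>Basis. \<Sum>c\<in>Basis. ((v \<bullet> b) * (w \<bullet> c)) * (\<integral>x. (x \<bullet> b) * (x \<bullet> c) \<partial>gauss_mu lam))"
    by (simp add: integrable_inner_mult)
  also have "\<dots> = (\<Sum>b\<in>Basis. (v \<bullet> b) * (w \<bullet> b) * lam\<^sup>2)"
    by (intro sum.cong refl) (simp add: integral_inner_Basis if_distrib cong: if_cong)
  also have "\<dots> = lam\<^sup>2 * (v \<bullet> w)"
    by (subst (3) euclidean_inner) (simp add: sum_distrib_left mult_ac)
  finally show ?thesis .
qed


section \<open>The Mehler kernel\<close>

text \<open>For 0 <= t < 1 this is the density of the law of t x + sqrt(1 - t^2) w, with w Gaussian,
  relative to \<open>gauss_mu lam\<close>. Taken relative to that measure instead of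
  \<open>lborel\<close> it is symmetric in x and z, the source of self-adjointness.\<close>

definition mehler :: "real \<Rightarrow> 'a::euclidean_space \<Rightarrow> 'a \<Rightarrow> real" where
  "mehler t x z = (1 / sqrt (1 - t\<^sup>2)) ^ DIM('a) *
     exp ((2 * t * (x \<bullet> z) - t\<^sup>2 * ((norm x)\<^sup>2 + (norm z)\<^sup>2)) / (2 * lam\<^sup>2 * (1 - t\<^sup>2)))"

text \<open>The Ornstein-Uhlenbeck semigroup in the variable t = exp(-time), so that composition
  multiplies parameters. Averaging over the noise w makes sup bounds and the action on affine
  functions immediate; the kernel form is recovered for 0 <= t < 1.\<close>

definition OU :: "real \<Rightarrow> ('a::euclidean_space \<Rightarrow> real) \<Rightarrow> 'a \<Rightarrow> real" where
  "OU t F x = (\<integral>w. F (t *\<^sub>R x + sqrt (1 - t\<^sup>2) *\<^sub>R w) \<partial>gauss_mu lam)"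

lemma mehler_commute: "mehler t x z = mehler t z x"
  by (simp add: mehler_def inner_commute add.commute)

lemma mehler_nonneg[simp]: "0 \<le> t \<Longrightarrow> t < 1 \<Longrightarrow> 0 \<le> mehler t x z"
  by (auto simp: mehler_def power_le_one_iff)

lemma borel_measurable_mehler[measurable (raw)]:
  assumes [measurable]: "f \<in> borel_measurable N" "g \<in> borel_measurable N"
  shows "(\<lambda>x. mehler t (f x) (g x :: 'a::euclidean_space)) \<in> borel_measurable N"
  unfolding mehler_def by measurable

lemma one_minus_square_pos: "0 \<le> t \<Longrightarrow> t < 1 \<Longrightarrow> 0 < 1 - t\<^sup>2" for t :: real
  by (simp add: abs_square_less_1)

text \<open>Completing the square: in the variable z = t x + s w, weight times kernel is a centred
  Gaussian in w, and \<open>s ^ DIM('a)\<close> is the Jacobian of the substitution.\<close>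

lemma mehler_gauss_pdf:
  fixes x w :: "'a::euclidean_space"
  assumes t: "0 \<le> t" "t < 1"
  defines "s \<equiv> sqrt (1 - t\<^sup>2)"
  shows "s ^ DIM('a) * (gauss_pdf lam (t *\<^sub>R x + s *\<^sub>R w) * mehler t x (t *\<^sub>R x + s *\<^sub>R w)) = gauss_pdf lam w"
proof -
  have s: "s > 0" "s\<^sup>2 = 1 - t\<^sup>2" using one_minus_square_pos[OF t] by (auto simp: s_def)
  define y where "y = t *\<^sub>R x + s *\<^sub>R w"
  define A B C where "A = x \<bullet> x" and "B = x \<bullet> w" and "C = w \<bullet> w"
  have y2: "(norm y)\<^sup>2 = t\<^sup>2 * A + 2 * t * s * B + s\<^sup>2 * C"
    unfolding y_def A_def B_def C_def power2_norm_eq_inner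
    by (simp add: inner_add_left inner_add_right inner_commute power2_eq_square algebra_simps)
  have xy: "x \<bullet> y = t * A + s * B" by (simp add: y_def A_def B_def inner_add_right)
  \<comment> \<open>The exponents of weight and kernel, multiplied by their common denominator 2
    lam^2 s^2.\<close>
  have key: "- s\<^sup>2 * (norm y)\<^sup>2 + (2 * t * (x \<bullet> y) - t\<^sup>2 * ((norm x)\<^sup>2 + (norm y)\<^sup>2)) = - s\<^sup>2 * (norm w)\<^sup>2"
  proof -
    have e: "s\<^sup>2 * Y + t\<^sup>2 * Y = Y" for Y :: real unfolding s by (simp add: algebra_simps)
    have "- s\<^sup>2 * (norm y)\<^sup>2 + (2 * t * (x \<bullet> y) - t\<^sup>2 * ((norm x)\<^sup>2 + (norm y)\<^sup>2))
       = - (s\<^sup>2 * (norm y)\<^sup>2 + t\<^sup>2 * (norm y)\<^sup>2) + 2 * t * (x \<bullet> y) - t\<^sup>2 * (norm x)\<^sup>2"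
      by (simp add: algebra_simps)
    also have "\<dots> = - s\<^sup>2 * (norm w)\<^sup>2"
      unfolding e y2 xy unfolding power2_norm_eq_inner A_def[symmetric] C_def[symmetric]
      by (simp add: algebra_simps power2_eq_square)
    finally show ?thesis .
  qed
  have ex: "- (norm y)\<^sup>2 / (2 * lam\<^sup>2) + (2 * t * (x \<bullet> y) - t\<^sup>2 * ((norm x)\<^sup>2 + (norm y)\<^sup>2)) / (2 * lam\<^sup>2 * (1 - t\<^sup>2))
     = - (norm w)\<^sup>2 / (2 * lam\<^sup>2)" (is "?l = ?r")
  proof -
    have "- N / L + A / (L * r) = - W / L" if "- r * N + A = - r * W" "L > 0" "r > 0" for N A L r W :: real
    proof -
      have "- N / L + A / (L * r) = (- r * N + A) / (L * r)" using that by (simp add: field_simps)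
      also have "\<dots> = - W / L" unfolding that(1) using that(2,3) by simp
      finally show ?thesis .
    qed
    from this[OF key] show ?thesis unfolding s(2)[symmetric] using lam s(1) by simp
  qed
  have "s ^ DIM('a) * (gauss_pdf lam y * mehler t x y) =
     (s ^ DIM('a) * (1 / s) ^ DIM('a)) * (1 / sqrt (2 * pi * lam\<^sup>2)) ^ DIM('a) *
      (exp (- (norm y)\<^sup>2 / (2 * lam\<^sup>2)) * exp ((2 * t * (x \<bullet> y) - t\<^sup>2 * ((norm x)\<^sup>2 + (norm y)\<^sup>2)) / (2 * lam\<^sup>2 * (1 - t\<^sup>2))))"
    unfolding gauss_pdf_eq mehler_def gauss_density_def s_def by (simp add: mult_ac)
  also have "\<dots> = gauss_pdf lam w"
    unfolding exp_add[symmetric] ex using s(1) 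
    by (simp add: gauss_pdf_eq gauss_density_def power_one_over)
  finally show ?thesis by (simp add: y_def)
qed

lemma integral_mehler:
  fixes F :: "'a::euclidean_space \<Rightarrow> real"
  assumes t: "0 \<le> t" "t < 1" and [measurable]: "F \<in> borel_measurable borel"
  shows "(\<integral>z. mehler t x z * F z \<partial>gauss_mu lam) = OU t F x"
proof -
  define s where "s = sqrt (1 - t\<^sup>2)"
  have s: "s > 0" using one_minus_square_pos[OF t] by (auto simp: s_def)
  have "(\<integral>z. mehler t x z * F z \<partial>gauss_mu lam) = (\<integral>z. gauss_pdf lam z * (mehler t x z * F z) \<partial>lborel)"
    by (subst integral_gauss_mu) auto
  also have "\<dots> = (\<integral>w. (s ^ DIM('a) * (gauss_pdf lam (t *\<^sub>R x + s *\<^sub>R w) * mehler t x (t *\<^sub>R x + s *\<^sub>R w))) 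
       * F (t *\<^sub>R x + s *\<^sub>R w) \<partial>lborel)"
    by (subst integral_lborel_affine[OF _ s, of _ "t *\<^sub>R x"]) (auto simp: mult_ac)
  also have "\<dots> = (\<integral>w. gauss_pdf lam w * F (t *\<^sub>R x + s *\<^sub>R w) \<partial>lborel)"
    unfolding s_def mehler_gauss_pdf[OF t] ..
  also have "\<dots> = OU t F x"
    unfolding OU_def s_def by (subst integral_gauss_mu) auto
  finally show ?thesis .
qed

text \<open>As a function of the middle variable x, the weight times both kernels has quadratic part
  - (p / q) |x|^2 / (2 lam^2) with p = 1 + t^2 and q = 1 - t^2. It is therefore a Gaussian with
  centre t (z + w) / p and scale factor sqrt(q / p); these are \<open>m\<close> and
  \<open>k\<close>.\<close>

lemma mehler_mult:
  fixes y z w :: "'a::euclidean_space"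
  assumes t: "0 \<le> t" "t < 1"
  defines "k \<equiv> sqrt ((1 - t\<^sup>2) / (1 + t\<^sup>2))" and "m \<equiv> (t / (1 + t\<^sup>2)) *\<^sub>R (z + w)"
  shows "k ^ DIM('a) * (gauss_pdf lam (m + k *\<^sub>R y) * (mehler t z (m + k *\<^sub>R y) * mehler t w (m + k *\<^sub>R y)))
     = mehler (t\<^sup>2) z w * gauss_pdf lam y"
proof -
  define p q where "p = 1 + t\<^sup>2" and "q = 1 - t\<^sup>2"
  have p: "p > 0" and q: "q > 0" using one_minus_square_pos[OF t] 
    by (auto simp: p_def q_def add_pos_nonneg)
  have k: "k > 0" "k\<^sup>2 = q / p" using p q by (auto simp: k_def p_def q_def)
  define x where "x = m + k *\<^sub>R y"
  define S where "S = (norm z)\<^sup>2 + (norm w)\<^sup>2"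
  \<comment> \<open>The denominator 1 - t^4 of the kernel at parameter t^2 is p q, which matches
    what remains after the square is completed.\<close>
  have pq: "1 - (t\<^sup>2)\<^sup>2 = p * q" by (simp add: p_def q_def algebra_simps power2_eq_square)
  have const: "k ^ DIM('a) * ((1 / sqrt q) ^ DIM('a) * (1 / sqrt q) ^ DIM('a)) = (1 / sqrt (p * q)) ^ DIM('a)"
  proof -
    have "k * ((1 / sqrt q) * (1 / sqrt q)) = 1 / sqrt (p * q)"
      using p q unfolding k_def p_def[symmetric] q_def[symmetric] 
      by (simp add: real_sqrt_divide real_sqrt_mult field_simps)
    then show ?thesis by (metis power_mult_distrib)
  qed
  have U: "(norm (z + w))\<^sup>2 = S + 2 * (z \<bullet> w)"
    unfolding S_def power2_norm_eq_inner by (simp add: inner_add_left inner_add_right inner_commute)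
  have sq: "p * (norm x)\<^sup>2 - 2 * t * (x \<bullet> (z + w)) = q * (norm y)\<^sup>2 - t\<^sup>2 / p * (norm (z + w))\<^sup>2"
  proof -
    have pm: "p *\<^sub>R m = t *\<^sub>R (z + w)" using p by (simp add: m_def p_def)
    have m2: "p * (m \<bullet> m) = t\<^sup>2 / p * (norm (z + w))\<^sup>2"
      using p unfolding m_def p_def[symmetric] power2_norm_eq_inner by (simp add: power2_eq_square)
    have "p * (norm x)\<^sup>2 - 2 * t * (x \<bullet> (z + w)) = p * (x \<bullet> x) - 2 * (x \<bullet> (p *\<^sub>R m))"
      unfolding pm power2_norm_eq_inner by simp
    also have "\<dots> = p * k\<^sup>2 * (y \<bullet> y) - p * (m \<bullet> m)"
      unfolding x_def by (simp add: inner_add_left inner_add_right inner_commute algebra_simps power2_eq_square)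
    finally show ?thesis unfolding m2 k(2) using p by (simp add: power2_norm_eq_inner)
  qed
  have zw: "z \<bullet> x + w \<bullet> x = x \<bullet> (z + w)" by (simp add: inner_add_right inner_commute)
  have key: "p * (- q * (norm x)\<^sup>2 + (2 * t * (z \<bullet> x) - t\<^sup>2 * ((norm z)\<^sup>2 + (norm x)\<^sup>2))
       + (2 * t * (w \<bullet> x) - t\<^sup>2 * ((norm w)\<^sup>2 + (norm x)\<^sup>2)))
      = 2 * t\<^sup>2 * (z \<bullet> w) - (t\<^sup>2)\<^sup>2 * S - p * q * (norm y)\<^sup>2" (is "p * ?e = _")
  proof -
    have "?e = - (p * (norm x)\<^sup>2 - 2 * t * (z \<bullet> x + w \<bullet> x)) - t\<^sup>2 * S"
      by (simp add: p_def q_def S_def algebra_simps)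
    then have "p * ?e = p * (t\<^sup>2 / p * (norm (z + w))\<^sup>2 - q * (norm y)\<^sup>2 - t\<^sup>2 * S)"
      unfolding zw sq by simp
    also have "\<dots> = t\<^sup>2 * (norm (z + w))\<^sup>2 - p * q * (norm y)\<^sup>2 - p * t\<^sup>2 * S"
      using p by (simp add: right_diff_distrib)
    finally show ?thesis unfolding U by (simp add: p_def algebra_simps power2_eq_square)
  qed
  have ex: "- (norm x)\<^sup>2 / (2 * lam\<^sup>2) + (2 * t * (z \<bullet> x) - t\<^sup>2 * ((norm z)\<^sup>2 + (norm x)\<^sup>2)) / (2 * lam\<^sup>2 * q)
       + (2 * t * (w \<bullet> x) - t\<^sup>2 * ((norm w)\<^sup>2 + (norm x)\<^sup>2)) / (2 * lam\<^sup>2 * q)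
     = (2 * t\<^sup>2 * (z \<bullet> w) - (t\<^sup>2)\<^sup>2 * S) / (2 * lam\<^sup>2 * (p * q)) - (norm y)\<^sup>2 / (2 * lam\<^sup>2)"  (is "?l = ?r")
  proof -
    have "- N / L + A / (L * q) + C / (L * q) = D / (L * (p * q)) - Y / L"
      if "p * (- q * N + A + C) = D - p * q * Y" "L > 0" for N A C D Y L :: real
    proof -
      have "- N / L + A / (L * q) + C / (L * q) = p * (- q * N + A + C) / (L * (p * q))"
        using that(2) p q by (simp add: field_simps)
      also have "\<dots> = D / (L * (p * q)) - Y / L"
        unfolding that(1) using that(2) p q by (simp add: field_simps)
      finally show ?thesis .
    qed
    from this[OF key] show ?thesis using lam by simp
  qed
  have "k ^ DIM('a) * (gauss_pdf lam x * (mehler t z x * mehler t w x)) =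
      (k ^ DIM('a) * ((1 / sqrt q) ^ DIM('a) * (1 / sqrt q) ^ DIM('a))) * (1 / sqrt (2 * pi * lam\<^sup>2)) ^ DIM('a) *
      (exp (- (norm x)\<^sup>2 / (2 * lam\<^sup>2)) * exp ((2 * t * (z \<bullet> x) - t\<^sup>2 * ((norm z)\<^sup>2 + (norm x)\<^sup>2)) / (2 * lam\<^sup>2 * q))
        * exp ((2 * t * (w \<bullet> x) - t\<^sup>2 * ((norm w)\<^sup>2 + (norm x)\<^sup>2)) / (2 * lam\<^sup>2 * q)))"
    unfolding gauss_pdf_eq mehler_def gauss_density_def q_def by (simp add: mult_ac)
  also have "\<dots> = mehler (t\<^sup>2) z w * gauss_pdf lam y"
  proof -
    have e: "exp (a - b / c) = exp a * exp (- b / c)" for a b c :: real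
      by (simp flip: exp_add)
    show ?thesis
      unfolding exp_add[symmetric] ex const
      unfolding e gauss_pdf_eq gauss_density_def mehler_def pq S_def
      by (simp only: mult_ac)
  qed
  finally show ?thesis by (simp add: x_def)
qed

text \<open>The Chapman-Kolmogorov relation for two equal parameters, which is the case used by the
  squaring iteration.\<close>

lemma integral_mehler_mehler:
  fixes z w :: "'a::euclidean_space"
  assumes t: "0 \<le> t" "t < 1"
  shows "(\<integral>x. mehler t z x * mehler t w x \<partial>gauss_mu lam) = mehler (t\<^sup>2) z w"
proof -
  define k where "k = sqrt ((1 - t\<^sup>2) / (1 + t\<^sup>2))"
  define m where "m = (t / (1 + t\<^sup>2)) *\<^sub>R (z + w)"
  have k: "k > 0" using one_minus_square_pos[OF t] by (auto simp: k_def add_pos_nonneg)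
  have "(\<integral>x. mehler t z x * mehler t w x \<partial>gauss_mu lam)
      = (\<integral>x. gauss_pdf lam x * (mehler t z x * mehler t w x) \<partial>lborel)"
    by (subst integral_gauss_mu) auto
  also have "\<dots> = (\<integral>y. k ^ DIM('a) * (gauss_pdf lam (m + k *\<^sub>R y) * (mehler t z (m + k *\<^sub>R y) * mehler t w (m + k *\<^sub>R y))) \<partial>lborel)"
    by (subst integral_lborel_affine[OF _ k, of _ m]) auto
  also have "\<dots> = (\<integral>y. mehler (t\<^sup>2) z w * gauss_pdf lam (y::'a) \<partial>lborel)"
    unfolding k_def m_def mehler_mult[OF t] ..
  also have "\<dots> = mehler (t\<^sup>2) z w"
    using has_integral_gauss_pdf[where 'a='a] by (simp add: has_bochner_integral_iff)
  finally show ?thesis .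
qed

text \<open>The gap between the two exponents is |z - t x|^2 / (2 lam^2 (1 - t^2)). The bound is
  free of x, so a bounded range of z gives a uniform bound.\<close>

lemma mehler_le:
  fixes x z :: "'a::euclidean_space"
  assumes t: "0 \<le> t" "t < 1"
  shows "mehler t x z \<le> (1 / sqrt (1 - t\<^sup>2)) ^ DIM('a) * exp ((norm z)\<^sup>2 / (2 * lam\<^sup>2))"
proof -
  have q: "1 - t\<^sup>2 > 0" by (rule one_minus_square_pos[OF t])
  have "0 \<le> (norm (z - t *\<^sub>R x))\<^sup>2" by simp
  also have "\<dots> = (norm z)\<^sup>2 - 2 * t * (x \<bullet> z) + t\<^sup>2 * (norm x)\<^sup>2"
    unfolding power2_norm_eq_inner by (simp add: inner_diff_left inner_diff_right inner_commute algebra_simps power2_eq_square)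
  finally have "2 * t * (x \<bullet> z) - t\<^sup>2 * ((norm x)\<^sup>2 + (norm z)\<^sup>2) \<le> (norm z)\<^sup>2 * (1 - t\<^sup>2)"
    by (simp add: algebra_simps)
  then have "(2 * t * (x \<bullet> z) - t\<^sup>2 * ((norm x)\<^sup>2 + (norm z)\<^sup>2)) / (2 * lam\<^sup>2 * (1 - t\<^sup>2))
      \<le> (norm z)\<^sup>2 * (1 - t\<^sup>2) / (2 * lam\<^sup>2 * (1 - t\<^sup>2))"
    using q lam by (intro divide_right_mono) auto
  also have "\<dots> = (norm z)\<^sup>2 / (2 * lam\<^sup>2)" using q by simp
  finally have "(2 * t * (x \<bullet> z) - t\<^sup>2 * ((norm x)\<^sup>2 + (norm z)\<^sup>2)) / (2 * lam\<^sup>2 * (1 - t\<^sup>2)) \<le> (norm z)\<^sup>2 / (2 * lam\<^sup>2)" .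
  then show ?thesis unfolding mehler_def using q by (intro mult_left_mono) auto
qed

lemma OU_const[simp]: "OU t (\<lambda>_. c) = (\<lambda>x::'a::euclidean_space. c)"
proof -
  interpret prob_space "gauss_mu lam :: 'a measure" by (rule prob_space_gauss_mu)
  show ?thesis by (auto simp: OU_def prob_space[unfolded space_gauss_mu])
qed

lemma OU_inner: "OU t (\<lambda>x. x \<bullet> v) = (\<lambda>x::'a::euclidean_space. t * (x \<bullet> v))"
proof -
  interpret prob_space "gauss_mu lam :: 'a measure" by (rule prob_space_gauss_mu)
  show ?thesis
    by (auto simp: OU_def inner_add_left integrable_inner integral_inner prob_space[unfolded space_gauss_mu])
qed

lemma borel_measurable_OU[measurable]:
  fixes F :: "'a::euclidean_space \<Rightarrow> real"
  assumes [measurable]: "F \<in> borel_measurable borel"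
  shows "OU t F \<in> borel_measurable borel"
proof -
  interpret prob_space "gauss_mu lam :: 'a measure" by (rule prob_space_gauss_mu)
  show ?thesis unfolding OU_def[abs_def] by measurable
qed

lemma OU_bound:
  fixes F :: "'a::euclidean_space \<Rightarrow> real"
  assumes [measurable]: "F \<in> borel_measurable borel" and B: "\<And>x. \<bar>F x\<bar> \<le> B"
  shows "\<bar>OU t F x\<bar> \<le> B"
proof -
  interpret prob_space "gauss_mu lam :: 'a measure" by (rule prob_space_gauss_mu)
  have i: "integrable (gauss_mu lam) (\<lambda>w. F (t *\<^sub>R x + sqrt (1 - t\<^sup>2) *\<^sub>R w))"
    by (rule integrable_gauss_mu_bounded[of _ B]) (auto simp: B)
  have "\<bar>OU t F x\<bar> \<le> (\<integral>w. \<bar>F (t *\<^sub>R x + sqrt (1 - t\<^sup>2) *\<^sub>R w)\<bar> \<partial>gauss_mu lam)"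
    unfolding OU_def by (rule integral_abs_bound)
  also have "\<dots> \<le> (\<integral>w. B \<partial>(gauss_mu lam :: 'a measure))"
    by (rule integral_mono) (use i B in auto)
  also have "\<dots> = B" by (simp add: prob_space[unfolded space_gauss_mu])
  finally show ?thesis .
qed

lemma integrable_gauss_mu_fst:
  fixes G :: "'a::euclidean_space \<Rightarrow> real"
  assumes G: "integrable (gauss_mu lam) G"
  shows "integrable (gauss_mu lam \<Otimes>\<^sub>M gauss_mu lam) (\<lambda>p::'a \<times> 'a. G (fst p))"
proof -
  interpret g: prob_space "gauss_mu lam :: 'a measure" by (rule prob_space_gauss_mu)
  have "integrable (distr (gauss_mu lam \<Otimes>\<^sub>M gauss_mu lam) (gauss_mu lam) (fst :: 'a \<times> 'a \<Rightarrow> 'a)) G"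
    using G by (simp add: g.distr_pair_fst)
  then show ?thesis by (rule integrable_distr[rotated]) simp
qed

text \<open>On the support of \<open>f\<close> the kernel is bounded uniformly in the other variable, so Fubini applies.\<close>
lemma OU_selfadjoint:
  fixes f G :: "'a::euclidean_space \<Rightarrow> real"
  assumes t: "0 \<le> t" "t < 1" and [measurable]: "f \<in> borel_measurable borel"
    and B: "\<And>x. \<bar>f x\<bar> \<le> B" and R: "\<And>x. norm x > R \<Longrightarrow> f x = 0"
    and G: "integrable (gauss_mu lam) G"
  shows "(\<integral>x. G x * OU t f x \<partial>gauss_mu lam) = (\<integral>z. f z * OU t G z \<partial>gauss_mu lam)"
proof -
  interpret g: prob_space "gauss_mu lam :: 'a measure" by (rule prob_space_gauss_mu)
  interpret p: pair_prob_space "gauss_mu lam :: 'a measure" "gauss_mu lam :: 'a measure" ..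
  have [measurable]: "G \<in> borel_measurable borel"
    using borel_measurable_integrable[OF G] by (simp cong: measurable_cong_sets)
  define K where "K = B * ((1 / sqrt (1 - t\<^sup>2)) ^ DIM('a) * exp (R\<^sup>2 / (2 * lam\<^sup>2)))"
  have B0: "B \<ge> 0" using B[of 0] by (rule order_trans[rotated]) auto
  have q: "1 - t\<^sup>2 > 0" by (rule one_minus_square_pos[OF t])
  have K: "\<bar>mehler t x z * f z\<bar> \<le> K" for x z
  proof (cases "norm z > R")
    case True then show ?thesis using R B0 q by (auto simp: K_def)
  next
    case False
    have "mehler t x z \<le> (1 / sqrt (1 - t\<^sup>2)) ^ DIM('a) * exp ((norm z)\<^sup>2 / (2 * lam\<^sup>2))"
      by (rule mehler_le[OF t])
    also have "\<dots> \<le> (1 / sqrt (1 - t\<^sup>2)) ^ DIM('a) * exp (R\<^sup>2 / (2 * lam\<^sup>2))"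
      using False q by (intro mult_left_mono) (auto intro!: divide_right_mono power_mono)
    finally have "\<bar>f z\<bar> * mehler t x z \<le> B * ((1 / sqrt (1 - t\<^sup>2)) ^ DIM('a) * exp (R\<^sup>2 / (2 * lam\<^sup>2)))"
      using B B0 t by (intro mult_mono) auto
    then show ?thesis using t by (simp add: K_def abs_mult mult.commute)
  qed
  have KG: "\<bar>G x * (mehler t x z * f z)\<bar> \<le> K * \<bar>G x\<bar>" for x z
    using mult_right_mono[OF K[of x z], of "\<bar>G x\<bar>"] by (simp add: abs_mult mult_ac)
  have int: "integrable (gauss_mu lam \<Otimes>\<^sub>M gauss_mu lam) (\<lambda>(x, z). G x * (mehler t x z * f z))"
  proof (rule Bochner_Integration.integrable_bound)
    show "integrable (gauss_mu lam \<Otimes>\<^sub>M gauss_mu lam) (\<lambda>p::'a \<times> 'a. K * G (fst p))"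
      using integrable_gauss_mu_fst[OF G] by simp
    show "AE p in gauss_mu lam \<Otimes>\<^sub>M gauss_mu lam. norm (case p of (x, z) \<Rightarrow> G x * (mehler t x z * f z)) \<le> norm (K * G (fst p))"
    proof (intro AE_I2)
      fix p :: "'a \<times> 'a"
      have "0 \<le> K" using K[of 0 0] by linarith
      then show "norm (case p of (x, z) \<Rightarrow> G x * (mehler t x z * f z)) \<le> norm (K * G (fst p))"
        using KG by (cases p) (simp add: abs_mult)
    qed
    show "(\<lambda>(x, z). G x * (mehler t x z * f z)) \<in> borel_measurable (gauss_mu lam \<Otimes>\<^sub>M gauss_mu lam)"
      by measurable
  qed
  have "G x * OU t f x = (\<integral>z. G x * (mehler t x z * f z) \<partial>gauss_mu lam)" for x
    using integral_mehler[OF t, of f x] by simp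
  then have "(\<integral>x. G x * OU t f x \<partial>gauss_mu lam) = (\<integral>x. \<integral>z. G x * (mehler t x z * f z) \<partial>gauss_mu lam \<partial>gauss_mu lam)"
    by (rule Bochner_Integration.integral_cong[OF refl])
  also have "\<dots> = (\<integral>z. \<integral>x. G x * (mehler t x z * f z) \<partial>gauss_mu lam \<partial>gauss_mu lam)"
    by (rule p.Fubini_integral[symmetric, OF int])
  also have "\<dots> = (\<integral>z. f z * OU t G z \<partial>gauss_mu lam)"
  proof (intro Bochner_Integration.integral_cong refl)
    fix z
    have "(\<integral>x. G x * (mehler t x z * f z) \<partial>gauss_mu lam) = (\<integral>x. f z * (mehler t z x * G x) \<partial>gauss_mu lam)"
      by (intro Bochner_Integration.integral_cong refl) (simp add: mehler_commute[of t _ z])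
    then show "(\<integral>x. G x * (mehler t x z * f z) \<partial>gauss_mu lam) = f z * OU t G z"
      using integral_mehler[OF t, of G z] by simp
  qed
  finally show ?thesis .
qed

text \<open>Self-adjointness applied to G = \<open>mehler t z\<close>, which is bounded by symmetry
  and \<open>mehler_le\<close>, moves the inner operator onto the kernel; the two kernels then
  compose to the one at t^2.\<close>

lemma OU_OU:
  fixes f :: "'a::euclidean_space \<Rightarrow> real"
  assumes t: "0 \<le> t" "t < 1" and [measurable]: "f \<in> borel_measurable borel"
    and B: "\<And>x. \<bar>f x\<bar> \<le> B" and R: "\<And>x. norm x > R \<Longrightarrow> f x = 0"
  shows "OU t (OU t f) z = OU (t\<^sup>2) f z"
proof -
  have t2: "0 \<le> t\<^sup>2" "t\<^sup>2 < 1" using one_minus_square_pos[OF t] by auto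
  have "integrable (gauss_mu lam) (\<lambda>x. mehler t z x)"
  proof (rule integrable_gauss_mu_bounded)
    show "\<bar>mehler t z x\<bar> \<le> (1 / sqrt (1 - t\<^sup>2)) ^ DIM('a) * exp ((norm z)\<^sup>2 / (2 * lam\<^sup>2))" for x
      using mehler_le[OF t, of x z] t by (simp add: mehler_commute)
  qed auto
  then have "(\<integral>x. mehler t z x * OU t f x \<partial>gauss_mu lam) = (\<integral>w. f w * OU t (mehler t z) w \<partial>gauss_mu lam)"
    using R by (intro OU_selfadjoint[OF t assms(3) B]) auto
  also have "\<dots> = (\<integral>w. f w * mehler (t\<^sup>2) z w \<partial>gauss_mu lam)"
  proof -
    have "OU t (mehler t z) w = mehler (t\<^sup>2) z w" for w
      using integral_mehler[OF t, of "mehler t z" w] integral_mehler_mehler[OF t, of w z]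
      by (simp add: mehler_commute[of _ w])
    then show ?thesis by simp
  qed
  finally show ?thesis
    by (simp add: integral_mehler[OF t, symmetric] integral_mehler[OF t2, symmetric] mult.commute)
qed

end

section \<open>Real inequalities for the expansion and the iteration\<close>

text \<open>For negative A it follows from exp(-A) >= 1 - A and (1 + A + A^2)(1 - A) = 1 - A^3 >= 1.
  Together with 1 + A <= exp A it gives a two-sided second-order remainder.\<close>

lemma exp_le_quadratic:
  fixes A :: real
  assumes "A \<le> 1"
  shows "exp A \<le> 1 + A + A\<^sup>2"
proof (cases "A \<ge> 0")
  case True then show ?thesis using exp_bound[of A] assms by simp
next
  case False
  have "exp A = 1 / exp (- A)" by (simp add: exp_minus field_simps)
  also have "\<dots> \<le> 1 / (1 - A)"
    using False exp_ge_add_one_self[of "-A"] by (intro divide_left_mono) auto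
  also have "\<dots> \<le> 1 + A + A\<^sup>2"
  proof -
    have "1 \<le> (1 + A + A\<^sup>2) * (1 - A)"
    proof -
      have "(1 + A + A\<^sup>2) * (1 - A) = 1 - A ^ 3" by (simp add: algebra_simps power2_eq_square power3_eq_cube)
      moreover have "A ^ 3 \<le> 0" using False by (simp add: power_le_zero_eq)
      ultimately show ?thesis by simp
    qed
    then show ?thesis using False by (simp add: divide_le_eq)
  qed
  finally show ?thesis .
qed

text \<open>If \<open>a t / (t\<^sup>2 * K)\<close> exceeded 1 then its values along \<open>t, t\<^sup>2, t\<^sup>4, \<dots>\<close>
  would grow doubly exponentially, contradicting the quadratic bound near 0.\<close>
lemma le_square_mult_of_squaring:
  fixes a :: "real \<Rightarrow> real"
  assumes t: "0 < t" "t < 1" and K: "0 \<le> K" and s0: "s0 > 0"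
    and sq: "\<And>s. 0 < s \<Longrightarrow> s < 1 \<Longrightarrow> (a s)\<^sup>2 \<le> K * a (s\<^sup>2)"
    and small: "\<And>s. 0 < s \<Longrightarrow> s \<le> s0 \<Longrightarrow> a s \<le> C * s\<^sup>2"
  shows "a t \<le> t\<^sup>2 * K"
proof (rule ccontr)
  assume neg: "\<not> a t \<le> t\<^sup>2 * K"
  have K: "K > 0"
  proof (rule ccontr)
    assume "\<not> K > 0"
    then have "K = 0" using K by simp
    then show False using neg sq[OF t] by simp
  qed
  define \<tau> where "\<tau> n = t ^ (2 ^ n)" for n :: nat
  define b where "b n = a (\<tau> n) / ((\<tau> n)\<^sup>2 * K)" for n
  have \<tau>: "0 < \<tau> n" "\<tau> n < 1" for n using t by (auto simp: \<tau>_def power_less_one_iff)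
  have \<tau>S: "\<tau> (Suc n) = (\<tau> n)\<^sup>2" for n by (simp add: \<tau>_def power_mult[symmetric] mult.commute)
  have b0: "b 0 > 1" using neg t K by (simp add: b_def \<tau>_def field_simps)
  have bS: "(b n)\<^sup>2 \<le> b (Suc n)" for n
  proof -
    have "(b n)\<^sup>2 = (a (\<tau> n))\<^sup>2 / ((\<tau> n)^4 * K\<^sup>2)"
      by (simp add: b_def power_divide power_mult_distrib flip: power_mult)
    also have "\<dots> \<le> (K * a ((\<tau> n)\<^sup>2)) / ((\<tau> n)^4 * K\<^sup>2)"
      by (intro divide_right_mono sq \<tau>) simp
    also have "\<dots> = b (Suc n)"
      using K \<tau>[of n] by (simp add: b_def \<tau>S field_simps power2_eq_square power4_eq_xxxx)
    finally show ?thesis .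
  qed
  have grow: "b 0 ^ (2 ^ n) \<le> b n" for n
  proof (induction n)
    case (Suc n)
    have "b 0 ^ (2 ^ Suc n) = (b 0 ^ (2 ^ n))\<^sup>2" by (simp add: power_mult[symmetric] mult.commute)
    also have "\<dots> \<le> (b n)\<^sup>2" using Suc b0 by (intro power_mono) auto
    finally show ?case using bS[of n] by simp
  qed simp
  \<comment> \<open>Used to weaken doubly exponential quantities to geometric ones:
    \<open>\<tau> n\<close> to t ^ n and \<open>b 0 ^ (2 ^ n)\<close> to
    \<open>b 0 ^ n\<close>.\<close>
  have pow: "n \<le> 2 ^ n" for n :: nat by (simp add: less_imp_le)
  have "(\<lambda>n. t ^ n) \<longlonglongrightarrow> 0" using t by (intro LIMSEQ_realpow_zero) auto
  then have "\<forall>\<^sub>F n in sequentially. t ^ n < s0" using s0 by (rule order_tendstoD)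
  then have e1: "\<forall>\<^sub>F n in sequentially. \<tau> n \<le> s0"
  proof eventually_elim
    case (elim n)
    have "\<tau> n \<le> t ^ n" unfolding \<tau>_def using t pow by (intro power_decreasing) auto
    then show ?case using elim by simp
  qed
  obtain n0 where "C / K < b 0 ^ n0" using real_arch_pow[OF b0] by blast
  then have "C / K < b 0 ^ n" if "n0 \<le> n" for n
    using \<open>C / K < b 0 ^ n0\<close> power_increasing[OF that, of "b 0"] b0 by linarith
  then have e2: "\<forall>\<^sub>F n in sequentially. b 0 ^ n > C / K"
    unfolding eventually_sequentially by blast
  obtain n where n: "\<tau> n \<le> s0" "b 0 ^ n > C / K"
    using eventually_happens[OF eventually_conj[OF e1 e2]] by auto
  have "b n \<le> C * (\<tau> n)\<^sup>2 / ((\<tau> n)\<^sup>2 * K)"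
    unfolding b_def using K n(1) \<tau> by (intro divide_right_mono small) auto
  also have "\<dots> = C / K" using \<tau>[of n] by simp
  finally have "b n \<le> C / K" .
  moreover have "b 0 ^ n \<le> b 0 ^ (2 ^ n)" using b0 pow by (intro power_increasing) auto
  ultimately show False using n(2) grow[of n] by simp
qed

text \<open>The discriminant criterion, which turns nonnegativity of all squared norms |g - r h|^2
  into the Cauchy-Schwarz inequality. If C = 0 the expression is affine in r, and boundedness below
  forces B = 0.\<close>

lemma square_le_of_quadratic_nonneg:
  fixes A B C :: real
  assumes C: "C \<ge> 0" and "\<And>r. 0 \<le> A - 2 * r * B + r\<^sup>2 * C"
  shows "B\<^sup>2 \<le> C * A"
proof (cases "C = 0")
  case True
  have "B = 0"
  proof (rule ccontr)
    \<comment> \<open>At this r the affine expression takes the value -1.\<close>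
    assume "B \<noteq> 0" then show False using assms(2)[of "(A + 1) / (2 * B)"] True by simp
  qed
  then show ?thesis using True by simp
next
  case False
  \<comment> \<open>r = B / C is the minimiser of the quadratic.\<close>
  then show ?thesis using assms(2)[of "B / C"] C by (simp add: field_simps power2_eq_square)
qed

section \<open>Expansion of the Mehler kernel at small parameter\<close>

context gaussian begin

text \<open>The terms 1 and s (x.z) / lam^2 are the contributions of the constant and linear modes.
  The normalising factor is 1 + O(s^2), and the exponent is s (x.z) / lam^2 + O(s^2) uniformly on
  the ball, so the remainder starts at order s^2.\<close>

lemma mehler_expansion:
  fixes R :: real
  assumes R: "R \<ge> 0"
  obtains s0 C where "s0 > 0" "s0 < 1" "C \<ge> 0"
    "\<And>s x (z::'a::euclidean_space). 0 < s \<Longrightarrow> s \<le> s0 \<Longrightarrow> norm x \<le> R \<Longrightarrow> norm z \<le> R \<Longrightarrow>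
       \<bar>mehler s x z - 1 - s * (x \<bullet> z) / lam\<^sup>2\<bar> \<le> C * s\<^sup>2"
proof -
  define K where "K = R\<^sup>2 / lam\<^sup>2"
  define N where "N = real (DIM('a))"
  have K: "K \<ge> 0" by (simp add: K_def)
  have N: "N \<ge> 0" by (simp add: N_def)
  \<comment> \<open>The three caps yield s <= 1/2, 2 K s <= 1 and 2 N s <= 1. They keep q = 1 - s^2
    at least 3/4, |A| at most 1 and N s^2 at most 1/2.\<close>
  define s0 where "s0 = min (1/2) (min (1 / (2 * K + 1)) (1 / (2 * N + 1)))"
  \<comment> \<open>6 N comes from the prefactor, whose excess 2 N s^2 is multiplied by exp A <= 3;
    4 K^2 + 2 K bounds A^2 and A - s P, relative to s^2.\<close>
  define C where "C = 4 * K\<^sup>2 + 2 * K + 6 * N"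
  show ?thesis
  proof (rule that[of s0 C])
    show "s0 > 0" "s0 < 1" "C \<ge> 0" using K N by (auto simp: s0_def C_def min_less_iff_disj)
    fix s :: real and x z :: 'a
    assume s: "0 < s" "s \<le> s0" and x: "norm x \<le> R" and z: "norm z \<le> R"
    have s1: "s \<le> 1/2" and sK: "2 * K * s \<le> 1" and sN: "2 * N * s \<le> 1"
    proof -
      show "s \<le> 1/2" using s by (simp add: s0_def)
      have "s \<le> 1 / (2 * K + 1)" using s by (simp add: s0_def)
      then have "s * (2 * K + 1) \<le> 1" using K by (simp add: field_simps)
      then show "2 * K * s \<le> 1" using s by (simp add: algebra_simps)
      have "s \<le> 1 / (2 * N + 1)" using s by (simp add: s0_def)
      then have "s * (2 * N + 1) \<le> 1" using N by (simp add: field_simps)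
      then show "2 * N * s \<le> 1" using s by (simp add: algebra_simps)
    qed
    define q where "q = 1 - s\<^sup>2"
    have s2: "s\<^sup>2 \<le> s / 2" using s s1 by (simp add: power2_eq_square)
    have q: "q \<ge> 3/4" "q \<le> 1" using s2 s1 by (auto simp: q_def)
    define P where "P = (x \<bullet> z) / lam\<^sup>2"
    define S where "S = ((norm x)\<^sup>2 + (norm z)\<^sup>2) / lam\<^sup>2"
    have P: "\<bar>P\<bar> \<le> K"
    proof -
      have "\<bar>x \<bullet> z\<bar> \<le> norm x * norm z" by (rule Cauchy_Schwarz_ineq2)
      also have "\<dots> \<le> R * R" using x z R by (intro mult_mono) auto
      finally show ?thesis using lam by (simp add: P_def K_def power2_eq_square divide_right_mono)
    qed
    have S: "0 \<le> S" "S \<le> 2 * K"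
    proof -
      show "0 \<le> S" by (simp add: S_def)
      have "(norm x)\<^sup>2 + (norm z)\<^sup>2 \<le> R\<^sup>2 + R\<^sup>2" using x z by (intro add_mono power_mono) auto
      then have "S \<le> (R\<^sup>2 + R\<^sup>2) / lam\<^sup>2" unfolding S_def by (intro divide_right_mono) auto
      then show "S \<le> 2 * K" by (simp add: K_def)
    qed
    define A where "A = (2 * s * P - s\<^sup>2 * S) / (2 * q)"
    define c where "c = (1 / sqrt q) ^ DIM('a)"
    have m: "mehler s x z = c * exp A"
    proof -
      have "(2 * s * (x \<bullet> z) - s\<^sup>2 * ((norm x)\<^sup>2 + (norm z)\<^sup>2)) / (2 * lam\<^sup>2 * q) = A"
        using lam q unfolding A_def P_def S_def by (simp add: field_simps)
      then show ?thesis unfolding mehler_def c_def q_def[symmetric] by simp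
    qed
    have A: "\<bar>A\<bar> \<le> 2 * K * s"
    proof -
      have "\<bar>2 * s * P - s\<^sup>2 * S\<bar> \<le> 2 * s * \<bar>P\<bar> + s\<^sup>2 * S"
        using s S by (simp add: abs_mult order_trans[OF abs_triangle_ineq4])
      also have "\<dots> \<le> 2 * s * K + s / 2 * (2 * K)"
        using s P S s2 K by (intro add_mono mult_mono) auto
      also have "\<dots> = 3 * s * K" by simp
      also have "\<dots> \<le> 2 * K * s * (2 * q)"
        using mult_left_mono[of "3/4" q "4 * (K * s)"] q K s by (simp add: algebra_simps)
      finally show ?thesis unfolding A_def using q by (simp add: pos_divide_le_eq abs_divide)
    qed
    have AP: "\<bar>A - s * P\<bar> \<le> 2 * K * s\<^sup>2"
    proof -
      have "A - s * P = s\<^sup>2 * (2 * s * P - S) / (2 * q)"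
        unfolding A_def using q by (simp add: field_simps) (simp add: q_def algebra_simps power2_eq_square)
      moreover have "\<bar>s\<^sup>2 * (2 * s * P - S)\<bar> \<le> s\<^sup>2 * (3 * K)"
      proof -
        have "\<bar>2 * s * P - S\<bar> \<le> 2 * s * \<bar>P\<bar> + S" using s S 
          by (simp add: abs_mult order_trans[OF abs_triangle_ineq4])
        also have "\<dots> \<le> 1 * K + 2 * K" using s s1 P S by (intro add_mono mult_mono) auto
        finally show ?thesis by (simp add: abs_mult mult_left_mono)
      qed
      moreover have "s\<^sup>2 * (3 * K) \<le> 2 * K * s\<^sup>2 * (2 * q)"
        using mult_left_mono[of "3/4" q "4 * (K * s\<^sup>2)"] q K by (simp add: algebra_simps)
      ultimately show ?thesis using q by (simp add: pos_divide_le_eq abs_divide)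
    qed
    have A1: "\<bar>A\<bar> \<le> 1" using A sK by simp
    have A2: "A\<^sup>2 \<le> 4 * K\<^sup>2 * s\<^sup>2" 
      using power_mono[OF A, of 2] by (simp add: power_mult_distrib)
    have e1: "\<bar>exp A - 1 - s * P\<bar> \<le> 4 * K\<^sup>2 * s\<^sup>2 + 2 * K * s\<^sup>2"
      using exp_le_quadratic[of A] A1 exp_ge_add_one_self[of A] A2 AP by linarith
    have e2: "exp A \<le> 3" 
    proof -
      have "A\<^sup>2 \<le> 1" using A1 by (simp add: abs_square_le_1)
      then show ?thesis using exp_le_quadratic[of A] A1 by linarith
    qed
    have c: "1 \<le> c" "c \<le> 1 + 2 * N * s\<^sup>2"
    proof -
      have rq: "q \<le> sqrt q" "sqrt q \<le> 1" "0 < sqrt q" 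
        using q by (auto intro!: real_le_rsqrt simp: power2_eq_square mult_left_le)
      show "1 \<le> c" unfolding c_def using rq by (intro one_le_power) auto
      have h: "N * s\<^sup>2 \<le> 1/2"
        using mult_left_mono[OF s2, of N] N sN s by (simp add: algebra_simps)
      have "c \<le> (1 / q) ^ DIM('a)" unfolding c_def using rq q by (intro power_mono frac_le) auto
      also have "\<dots> = 1 / q ^ DIM('a)" by (simp add: power_one_over)
      also have "\<dots> \<le> 1 / (1 - N * s\<^sup>2)"
        using Bernoulli_inequality[of "- s\<^sup>2" "DIM('a)"] q h 
        by (intro frac_le) (auto simp: q_def N_def)
      also have "\<dots> \<le> 1 + 2 * N * s\<^sup>2"
      proof -
        have "0 \<le> N * s\<^sup>2 * (1 - 2 * (N * s\<^sup>2))" using h N by simp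
        then show ?thesis using h by (simp add: divide_le_eq algebra_simps)
      qed
      finally show "c \<le> 1 + 2 * N * s\<^sup>2" .
    qed
    have "\<bar>c * exp A - 1 - s * P\<bar> \<le> (c - 1) * exp A + \<bar>exp A - 1 - s * P\<bar>"
    proof -
      have "c * exp A - 1 - s * P = (c - 1) * exp A + (exp A - 1 - s * P)" by (simp add: algebra_simps)
      moreover have "0 \<le> (c - 1) * exp A" using c by simp
      ultimately show ?thesis by linarith
    qed
    also have "\<dots> \<le> (2 * N * s\<^sup>2) * 3 + (4 * K\<^sup>2 * s\<^sup>2 + 2 * K * s\<^sup>2)"
      using c e1 e2 N by (intro add_mono mult_mono) auto
    also have "\<dots> = C * s\<^sup>2" by (simp add: C_def algebra_simps)
    finally show "\<bar>mehler s x z - 1 - s * (x \<bullet> z) / lam\<^sup>2\<bar> \<le> C * s\<^sup>2"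
      unfolding m P_def by simp
  qed
qed

end

section \<open>The inequality for test functions\<close>

text \<open>Boundedness and bounded support are what Fubini and the uniform kernel expansion use;
  differentiability enters only later, when increments are compared with the gradient.\<close>

locale gaussian_cutoff = gaussian lam for lam +
  fixes f :: "'a::euclidean_space \<Rightarrow> real" and B R :: real
  assumes f_measurable[measurable]: "f \<in> borel_measurable borel"
    and f_bound: "\<And>x. \<bar>f x\<bar> \<le> B"
    and f_support: "\<And>x. norm x > R \<Longrightarrow> f x = 0"
    and R_nonneg: "R \<ge> 0"
begin

definition mean :: real where "mean = (\<integral>x. f x \<partial>gauss_mu lam)"

text \<open>Coefficient vector of the L^2 projection onto linear functions: the coordinates are
  orthogonal with second moment lam^2, hence the division by lam^2.\<close>

definition slope :: 'a where "slope = (1 / lam\<^sup>2) *\<^sub>R (\<Sum>b\<in>Basis. (\<integral>x. f x * (x \<bullet> b) \<partial>gauss_mu lam) *\<^sub>R b)"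

definition corr :: "real \<Rightarrow> real" where "corr t = (\<integral>x. f x * OU t f x \<partial>gauss_mu lam)"

definition residual :: real where
  "residual = (\<integral>x. (f x - mean - slope \<bullet> x)\<^sup>2 \<partial>gauss_mu lam)"

text \<open>\<open>residual_corr t\<close> is \<open>\<langle>h, P\<^sub>t h\<rangle>\<close> for \<open>h x = f x - mean - slope \<bullet> x\<close>;
  its limit at \<open>t = 1\<close>, where the Mehler kernel degenerates, is \<open>residual\<close>.\<close>
definition residual_corr :: "real \<Rightarrow> real" where
  "residual_corr t = corr t - mean\<^sup>2 - t * lam\<^sup>2 * (slope \<bullet> slope)"

lemma B_nonneg: "B \<ge> 0"
  using f_bound[of 0] by (rule order_trans[rotated]) simp

lemma integrable_bounded_mult_inner:
  assumes [measurable]: "u \<in> borel_measurable borel" and "\<And>x. \<bar>u x\<bar> \<le> B"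
  shows "integrable (gauss_mu lam) (\<lambda>x. u x * ((x::'a) \<bullet> v))"
proof (rule Bochner_Integration.integrable_bound[where f="\<lambda>x. B * (x \<bullet> v)"])
  show "integrable (gauss_mu lam) (\<lambda>x. B * (x \<bullet> v))" by (simp add: integrable_inner)
  show "AE x in gauss_mu lam. norm (u x * (x \<bullet> v)) \<le> norm (B * (x \<bullet> v))"
    using assms(2) B_nonneg by (intro AE_I2) (simp add: abs_mult mult_right_mono)
qed simp

lemma integral_mult_inner: "(\<integral>x. f x * (x \<bullet> v) \<partial>gauss_mu lam) = lam\<^sup>2 * (slope \<bullet> v)"
proof -
  have "f x * (x \<bullet> v) = (\<Sum>b\<in>Basis. (f x * (x \<bullet> b)) * (v \<bullet> b))" for x
    by (subst euclidean_inner) (simp add: sum_distrib_left mult_ac)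
  then have "(\<integral>x. f x * (x \<bullet> v) \<partial>gauss_mu lam) = (\<Sum>b\<in>Basis. (\<integral>x. f x * (x \<bullet> b) \<partial>gauss_mu lam) * (v \<bullet> b))"
    by (simp add: integrable_bounded_mult_inner f_bound)
  also have "\<dots> = lam\<^sup>2 * (slope \<bullet> v)"
    using lam by (simp add: slope_def inner_sum_left) (simp add: inner_commute)
  finally show ?thesis .
qed

text \<open>One expansion serves <h, h>, <h, P_t h> and <P_t h, P_t h>: u and w are f or P_t f, with
  factor p or q equal to 1 for f and t for P_t f, because P_t multiplies linear functions by
  t.\<close>

lemma integral_affine_residuals:
  assumes [measurable]: "u \<in> borel_measurable borel" "w \<in> borel_measurable borel"
    and b: "\<And>x. \<bar>u x\<bar> \<le> B" "\<And>x. \<bar>w x\<bar> \<le> B"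
    and m: "(\<integral>x. u x \<partial>gauss_mu lam) = mean" "(\<integral>x. w x \<partial>gauss_mu lam) = mean"
    and l: "\<And>v. (\<integral>x. u x * (x \<bullet> v) \<partial>gauss_mu lam) = p * lam\<^sup>2 * (slope \<bullet> v)"
           "\<And>v. (\<integral>x. w x * (x \<bullet> v) \<partial>gauss_mu lam) = q * lam\<^sup>2 * (slope \<bullet> v)"
  shows "integrable (gauss_mu lam) (\<lambda>x. (u x - mean - p * (slope \<bullet> x)) * (w x - mean - q * (slope \<bullet> x)))"
    and "(\<integral>x. (u x - mean - p * (slope \<bullet> x)) * (w x - mean - q * (slope \<bullet> x)) \<partial>gauss_mu lam)
     = (\<integral>x. u x * w x \<partial>gauss_mu lam) - mean\<^sup>2 - p * q * lam\<^sup>2 * (slope \<bullet> slope)"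
proof -
  interpret g: prob_space "gauss_mu lam :: 'a measure" by (rule prob_space_gauss_mu)
  have e: "(u x - mean - p * (slope \<bullet> x)) * (w x - mean - q * (slope \<bullet> x)) =
      u x * w x - mean * u x - mean * w x + mean\<^sup>2 - q * (u x * (x \<bullet> slope)) - p * (w x * (x \<bullet> slope))
      + mean * (p + q) * (x \<bullet> slope) + p * q * ((x \<bullet> slope) * (x \<bullet> slope))" for x
    by (simp add: algebra_simps power2_eq_square inner_commute)
  have i: "integrable (gauss_mu lam) u" "integrable (gauss_mu lam) w"
    by (auto intro!: integrable_gauss_mu_bounded b)
  have i2: "integrable (gauss_mu lam) (\<lambda>x. u x * w x)"
    by (rule integrable_gauss_mu_bounded[of _ "B * B"]) (auto simp: abs_mult intro!: mult_mono b B_nonneg)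
  note i3 = integrable_bounded_mult_inner[OF assms(1) b(1)] integrable_bounded_mult_inner[OF assms(2) b(2)]
  show "integrable (gauss_mu lam) (\<lambda>x. (u x - mean - p * (slope \<bullet> x)) * (w x - mean - q * (slope \<bullet> x)))"
    unfolding e using i i2 i3 by (simp add: integrable_inner integrable_inner_mult)
  show "(\<integral>x. (u x - mean - p * (slope \<bullet> x)) * (w x - mean - q * (slope \<bullet> x)) \<partial>gauss_mu lam)
     = (\<integral>x. u x * w x \<partial>gauss_mu lam) - mean\<^sup>2 - p * q * lam\<^sup>2 * (slope \<bullet> slope)"
    unfolding e using i i2 i3 g.prob_space
    by (simp add: integrable_inner integrable_inner_mult integral_inner integral_inner_mult m l)
       (simp add: algebra_simps power2_eq_square)
qed

lemma integral_mult_OU: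
  assumes "0 \<le> t" "t < 1" "integrable (gauss_mu lam) G"
  shows "(\<integral>x. G x * OU t f x \<partial>gauss_mu lam) = (\<integral>z. f z * OU t G z \<partial>gauss_mu lam)"
  using assms f_bound f_support by (intro OU_selfadjoint[where B=B and R=R]) auto

text \<open>Invariance of the Gaussian measure, obtained from self-adjointness tested against the
  constant 1.\<close>

lemma integral_OU:
  assumes t: "0 \<le> t" "t < 1"
  shows "(\<integral>x. OU t f x \<partial>gauss_mu lam) = mean"
proof -
  interpret g: prob_space "gauss_mu lam :: 'a measure" by (rule prob_space_gauss_mu)
  show ?thesis using integral_mult_OU[OF t, of "\<lambda>_. 1"] by (simp add: mean_def)
qed

lemma integral_OU_inner:
  assumes t: "0 \<le> t" "t < 1"
  shows "(\<integral>x. OU t f x * (x \<bullet> v) \<partial>gauss_mu lam) = t * lam\<^sup>2 * (slope \<bullet> v)"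
proof -
  have "(\<integral>x. OU t f x * (x \<bullet> v) \<partial>gauss_mu lam) = (\<integral>x. (x \<bullet> v) * OU t f x \<partial>gauss_mu lam)"
    by (simp only: mult.commute)
  also have "\<dots> = (\<integral>x. t * (f x * (x \<bullet> v)) \<partial>gauss_mu lam)"
    using integral_mult_OU[OF t integrable_inner] by (simp add: OU_inner mult.left_commute)
  also have "\<dots> = t * lam\<^sup>2 * (slope \<bullet> v)" by (simp add: integral_mult_inner)
  finally show ?thesis .
qed

lemma integrable_f: "integrable (gauss_mu lam) f"
  by (rule integrable_gauss_mu_bounded[of _ B]) (auto simp: f_bound)

text \<open>Moving one operator across and composing squares the parameter, which is what drives the
  iteration.\<close>

lemma integral_OU_square:
  assumes t: "0 \<le> t" "t < 1"
  shows "(\<integral>x. OU t f x * OU t f x \<partial>gauss_mu lam) = corr (t\<^sup>2)"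
proof -
  have "integrable (gauss_mu lam) (OU t f)"
    by (rule integrable_gauss_mu_bounded[of _ B]) (auto intro!: OU_bound f_bound)
  then have "(\<integral>x. OU t f x * OU t f x \<partial>gauss_mu lam) = (\<integral>x. f x * OU t (OU t f) x \<partial>gauss_mu lam)"
    by (rule integral_mult_OU[OF t])
  moreover have "OU t (OU t f) x = OU (t\<^sup>2) f x" for x
    using t f_bound f_support by (intro OU_OU[where B=B and R=R]) auto
  ultimately show ?thesis by (simp add: corr_def)
qed

text \<open>Pythagoras for the orthogonal splitting of f into constant, linear part and
  residual.\<close>

lemma residual_eq: "residual = (\<integral>x. (f x)\<^sup>2 \<partial>gauss_mu lam) - mean\<^sup>2 - lam\<^sup>2 * (slope \<bullet> slope)"
proof -
  have m: "(\<integral>x. f x \<partial>gauss_mu lam) = mean" by (simp add: mean_def)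
  have l: "(\<integral>x. f x * (x \<bullet> v) \<partial>gauss_mu lam) = 1 * lam\<^sup>2 * (slope \<bullet> v)" for v
    by (simp add: integral_mult_inner)
  show ?thesis
    using integral_affine_residuals(2)[OF f_measurable f_measurable f_bound f_bound m m l l]
    by (simp add: residual_def power2_eq_square)
qed

text \<open>Cauchy-Schwarz for h and P_t h, read off from the squared norm of P_t h - r h being
  nonnegative for every real r; the squared norm of P_t h is <h, P_{t^2} h>.\<close>

lemma residual_corr_square_le:
  assumes t: "0 < t" "t < 1"
  shows "(residual_corr t)\<^sup>2 \<le> residual * residual_corr (t\<^sup>2)"
proof (rule square_le_of_quadratic_nonneg)
  show "0 \<le> residual" by (simp add: residual_def)
  fix r :: real
  have t': "0 \<le> t" using t by simp
  have OUm: "OU t f \<in> borel_measurable borel" by simp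
  have OUb: "\<bar>OU t f x\<bar> \<le> B" for x by (intro OU_bound f_bound) simp
  have fm: "(\<integral>x. f x \<partial>gauss_mu lam) = mean" by (simp add: mean_def)
  have fl: "(\<integral>x. f x * (x \<bullet> v) \<partial>gauss_mu lam) = 1 * lam\<^sup>2 * (slope \<bullet> v)" for v
    by (simp add: integral_mult_inner)
  note I = integral_OU[OF t' t(2)] integral_OU_inner[OF t' t(2)]
  let ?H = "\<lambda>x. f x - mean - 1 * (slope \<bullet> x)" and ?G = "\<lambda>x. OU t f x - mean - t * (slope \<bullet> x)"
  note HH = integral_affine_residuals[OF f_measurable f_measurable f_bound f_bound fm fm fl fl]
  note HG = integral_affine_residuals[OF f_measurable OUm f_bound OUb fm I(1) fl I(2)]
  note GG = integral_affine_residuals[OF OUm OUm OUb OUb I(1) I(1) I(2) I(2)]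
  have "0 \<le> (\<integral>x. (?G x - r * ?H x)\<^sup>2 \<partial>gauss_mu lam)" by simp
  also have "\<dots> = (\<integral>x. ?G x * ?G x - 2 * r * (?H x * ?G x) + r\<^sup>2 * (?H x * ?H x) \<partial>gauss_mu lam)"
    by (intro Bochner_Integration.integral_cong refl) (simp add: power2_eq_square algebra_simps)
  also have "\<dots> = (\<integral>x. ?G x * ?G x \<partial>gauss_mu lam) - 2 * r * (\<integral>x. ?H x * ?G x \<partial>gauss_mu lam)
     + r\<^sup>2 * (\<integral>x. ?H x * ?H x \<partial>gauss_mu lam)"
    using HH(1) HG(1) GG(1) by simp
  also have "\<dots> = residual_corr (t\<^sup>2) - 2 * r * residual_corr t + r\<^sup>2 * residual"
    unfolding HH(2) HG(2) GG(2) integral_OU_square[OF t' t(2)] residual_eq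
    by (simp add: residual_corr_def corr_def power2_eq_square)
  finally show "0 \<le> residual_corr (t\<^sup>2) - 2 * r * residual_corr t + r\<^sup>2 * residual" .
qed

lemma residual_corr_small:
  obtains s0 C where "s0 > 0" "\<And>s. 0 < s \<Longrightarrow> s \<le> s0 \<Longrightarrow> residual_corr s \<le> C * s\<^sup>2"
proof -
  interpret g: prob_space "gauss_mu lam :: 'a measure" by (rule prob_space_gauss_mu)
  obtain s0 C where s0: "s0 > 0" "s0 < 1" and C: "C \<ge> 0"
    and ex: "\<And>s x (z::'a::euclidean_space). 0 < s \<Longrightarrow> s \<le> s0 \<Longrightarrow> norm x \<le> R \<Longrightarrow> norm z \<le> R \<Longrightarrow>
       \<bar>mehler s x z - 1 - s * (x \<bullet> z) / lam\<^sup>2\<bar> \<le> C * s\<^sup>2"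
    using mehler_expansion[OF R_nonneg, where 'a='a] by blast
  show ?thesis
  \<comment> \<open>One factor B bounds f z inside the kernel integral, the other bounds f x outside
    it.\<close>
  proof (rule that[OF s0(1), of "B * (B * C)"])
    fix s assume s: "0 < s" "s \<le> s0"
    then have s1: "0 \<le> s" "s < 1" using s0 by auto
    \<comment> \<open>\<open>E\<close> is P_s h. Its kernel representation acts on f with the
      constant and linear modes subtracted, so it is of order s^2 for x in the ball.\<close>
    define E where "E x = OU s f x - mean - s * (x \<bullet> slope)" for x
    have E: "\<bar>E x\<bar> \<le> B * C * s\<^sup>2" if x: "norm x \<le> R" for x
    proof -
      have bd: "\<bar>(mehler s x z - 1 - s * (x \<bullet> z) / lam\<^sup>2) * f z\<bar> \<le> B * C * s\<^sup>2" for z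
      proof (cases "norm z > R")
        case True then show ?thesis using f_support B_nonneg C by simp
      next
        case False
        then have "\<bar>mehler s x z - 1 - s * (x \<bullet> z) / lam\<^sup>2\<bar> * \<bar>f z\<bar> \<le> (C * s\<^sup>2) * B"
          using ex[OF s x, of z] f_bound C by (intro mult_mono) auto
        then show ?thesis by (simp add: abs_mult mult_ac)
      qed
      have i: "integrable (gauss_mu lam) (\<lambda>z. (mehler s x z - 1 - s * (x \<bullet> z) / lam\<^sup>2) * f z)"
        by (rule integrable_gauss_mu_bounded[OF _ bd]) simp
      have i2: "integrable (gauss_mu lam) (\<lambda>z. f z * (z \<bullet> x))"
        by (intro integrable_bounded_mult_inner f_bound) simp
      have "(\<integral>z. mehler s x z * f z \<partial>gauss_mu lam)
         = (\<integral>z. (mehler s x z - 1 - s * (x \<bullet> z) / lam\<^sup>2) * f z + f z + (s / lam\<^sup>2) * (f z * (z \<bullet> x)) \<partial>gauss_mu lam)"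
        by (intro Bochner_Integration.integral_cong refl) (simp add: algebra_simps inner_commute)
      also have "\<dots> = (\<integral>z. (mehler s x z - 1 - s * (x \<bullet> z) / lam\<^sup>2) * f z \<partial>gauss_mu lam) + mean + s * (slope \<bullet> x)"
        using i i2 integrable_f lam by (simp add: integral_mult_inner mean_def)
      finally have "E x = (\<integral>z. (mehler s x z - 1 - s * (x \<bullet> z) / lam\<^sup>2) * f z \<partial>gauss_mu lam)"
        unfolding E_def using integral_mehler[OF s1 f_measurable, of x] by (simp add: inner_commute)
      also have "\<bar>\<dots>\<bar> \<le> (\<integral>z. \<bar>(mehler s x z - 1 - s * (x \<bullet> z) / lam\<^sup>2) * f z\<bar> \<partial>gauss_mu lam)"
        by (rule integral_abs_bound)
      also have "\<dots> \<le> (\<integral>z. B * C * s\<^sup>2 \<partial>(gauss_mu lam :: 'a measure))"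
        using i bd by (intro integral_mono) auto
      also have "\<dots> = B * C * s\<^sup>2" using g.prob_space by simp
      finally show ?thesis .
    qed
    have fE: "\<bar>f x * E x\<bar> \<le> B * (B * C) * s\<^sup>2" for x
    proof (cases "norm x > R")
      case True then show ?thesis using f_support B_nonneg C by simp
    next
      case False
      then have "\<bar>f x\<bar> * \<bar>E x\<bar> \<le> B * (B * C * s\<^sup>2)"
        using E f_bound B_nonneg by (intro mult_mono) auto
      then show ?thesis by (simp add: abs_mult mult_ac)
    qed
    have iO: "integrable (gauss_mu lam) (\<lambda>x. f x * OU s f x)"
      by (rule integrable_gauss_mu_bounded[of _ "B * B"])
         (auto simp: abs_mult intro!: mult_mono f_bound B_nonneg OU_bound)
    have i2: "integrable (gauss_mu lam) (\<lambda>z. f z * (z \<bullet> slope))"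
      by (intro integrable_bounded_mult_inner f_bound) simp
    have fEe: "f x * E x = f x * OU s f x - mean * f x - s * (f x * (x \<bullet> slope))" for x
      by (simp add: E_def algebra_simps)
    \<comment> \<open>P_s h is orthogonal to affine functions, so pairing it with f gives the same
      value as pairing it with h; the factor f x restricts x to the ball where \<open>E\<close> is
      controlled.\<close>
    have "residual_corr s = (\<integral>x. f x * E x \<partial>gauss_mu lam)"
      unfolding fEe using iO i2 integrable_f
      by (simp add: integral_mult_inner residual_corr_def corr_def mean_def power2_eq_square)
    also have "\<dots> \<le> (\<integral>x. B * (B * C) * s\<^sup>2 \<partial>(gauss_mu lam :: 'a measure))"
    proof (intro integral_mono)
      show "integrable (gauss_mu lam) (\<lambda>x. f x * E x)"
        unfolding fEe using iO i2 integrable_f by simp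
      show "f x * E x \<le> B * (B * C) * s\<^sup>2" for x using fE[of x] by linarith
    qed simp
    also have "\<dots> = B * (B * C) * s\<^sup>2" using g.prob_space by simp
    finally show "residual_corr s \<le> B * (B * C) * s\<^sup>2" .
  qed
qed

lemma residual_corr_le:
  assumes t: "0 < t" "t < 1"
  shows "residual_corr t \<le> t\<^sup>2 * residual"
proof -
  obtain s0 C where "s0 > 0" "\<And>s. 0 < s \<Longrightarrow> s \<le> s0 \<Longrightarrow> residual_corr s \<le> C * s\<^sup>2"
    using residual_corr_small by blast
  moreover have "0 \<le> residual" by (simp add: residual_def)
  ultimately show ?thesis
    by (intro le_square_mult_of_squaring[OF t]) (auto simp: residual_corr_square_le)
qed


section \<open>Mean square increments and their limit as t tends to 1\<close>

text \<open>Expanding the square, the two pure terms agree because t X + sqrt(1 - t^2) W has the law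
  of X, and the mixed term is \<open>corr t\<close>.\<close>

lemma corr_eq_increments:
  assumes t: "0 \<le> t" "t < 1"
  shows "(\<integral>(x, w). (f x - f (t *\<^sub>R x + sqrt (1 - t\<^sup>2) *\<^sub>R w))\<^sup>2 \<partial>(gauss_mu lam \<Otimes>\<^sub>M gauss_mu lam))
     = 2 * ((\<integral>x. (f x)\<^sup>2 \<partial>gauss_mu lam) - corr t)"
proof -
  interpret g: prob_space "gauss_mu lam :: 'a measure" by (rule prob_space_gauss_mu)
  interpret p: pair_prob_space "gauss_mu lam :: 'a measure" "gauss_mu lam :: 'a measure" ..
  define y where "y x w = t *\<^sub>R x + sqrt (1 - t\<^sup>2) *\<^sub>R w" for x w :: 'a
  have ym[measurable]: "y x \<in> borel_measurable borel" for x unfolding y_def by measurable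
  have f2m: "(\<lambda>x. (f x)\<^sup>2) \<in> borel_measurable borel" by measurable
  have f2b: "\<bar>(f x)\<^sup>2\<bar> \<le> B\<^sup>2" for x
    using power_mono[OF f_bound, of x 2] by simp
  have f2s: "(f x)\<^sup>2 = 0" if "norm x > R" for x using f_support[OF that] by simp
  have bd: "\<bar>(f u - f v)\<^sup>2\<bar> \<le> (2 * B)\<^sup>2" for u v
  proof -
    have "\<bar>f u - f v\<bar> \<le> 2 * B" using f_bound[of u] f_bound[of v] by linarith
    from power_mono[OF this, of 2] show ?thesis by simp
  qed
  have int: "integrable (gauss_mu lam \<Otimes>\<^sub>M gauss_mu lam) (\<lambda>(x, w). (f x - f (y x w))\<^sup>2)"
  proof (rule p.P.integrable_const_bound[of _ "(2 * B)\<^sup>2"])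
    show "AE p in gauss_mu lam \<Otimes>\<^sub>M gauss_mu lam. norm (case p of (x, w) \<Rightarrow> (f x - f (y x w))\<^sup>2) \<le> (2 * B)\<^sup>2"
      using bd by (intro AE_I2) (auto split: prod.splits)
    show "(\<lambda>(x, w). (f x - f (y x w))\<^sup>2) \<in> borel_measurable (gauss_mu lam \<Otimes>\<^sub>M gauss_mu lam)"
      unfolding y_def by measurable
  qed
  have inner: "(\<integral>w. (f x - f (y x w))\<^sup>2 \<partial>gauss_mu lam) = (f x)\<^sup>2 - 2 * (f x * OU t f x) + OU t (\<lambda>x. (f x)\<^sup>2) x" for x
  proof -
    have i1: "integrable (gauss_mu lam) (\<lambda>w. f (y x w))"
      by (rule integrable_gauss_mu_bounded[of _ B]) (auto simp: f_bound)
    have i2: "integrable (gauss_mu lam) (\<lambda>w. (f (y x w))\<^sup>2)"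
      by (rule integrable_gauss_mu_bounded[OF _ f2b]) simp
    have "(\<integral>w. (f x - f (y x w))\<^sup>2 \<partial>gauss_mu lam) = (\<integral>w. (f x)\<^sup>2 - 2 * f x * f (y x w) + (f (y x w))\<^sup>2 \<partial>gauss_mu lam)"
      by (intro Bochner_Integration.integral_cong refl) (simp add: power2_eq_square algebra_simps)
    also have "\<dots> = (f x)\<^sup>2 - 2 * (f x * OU t f x) + OU t (\<lambda>x. (f x)\<^sup>2) x"
      using i1 i2 g.prob_space by (simp add: OU_def y_def)
    finally show ?thesis .
  qed
  \<comment> \<open>Invariance of the measure for f^2, again as self-adjointness against the
    constant 1.\<close>
  have "(\<integral>x. OU t (\<lambda>x. (f x)\<^sup>2) x \<partial>gauss_mu lam) = (\<integral>x. (f x)\<^sup>2 \<partial>gauss_mu lam)"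
    using OU_selfadjoint[where f="\<lambda>x. (f x)\<^sup>2" and B="B\<^sup>2" and R=R and G="\<lambda>_. 1", OF t f2m f2b f2s] by simp
  moreover have "integrable (gauss_mu lam) (\<lambda>x. (f x)\<^sup>2)"
    by (rule integrable_gauss_mu_bounded[OF f2m f2b])
  moreover have "integrable (gauss_mu lam) (OU t (\<lambda>x. (f x)\<^sup>2))"
    by (rule integrable_gauss_mu_bounded[OF _ OU_bound[OF f2m f2b]]) simp
  moreover have "integrable (gauss_mu lam) (\<lambda>x. f x * OU t f x)"
    by (rule integrable_gauss_mu_bounded[of _ "B * B"])
       (auto simp: abs_mult intro!: mult_mono f_bound B_nonneg OU_bound)
  ultimately have "(\<integral>x. (\<integral>w. (f x - f (y x w))\<^sup>2 \<partial>gauss_mu lam) \<partial>gauss_mu lam)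
     = 2 * ((\<integral>x. (f x)\<^sup>2 \<partial>gauss_mu lam) - corr t)"
    unfolding inner by (simp add: corr_def)
  then show ?thesis
    using p.integral_fst'[OF int] by (simp add: y_def)
qed

text \<open>The bound on \<open>residual_corr\<close> below t = 1 bounds the increments from below.
  Divided by 1 - t^2 these converge to the average of (G x . w)^2, whose mean over w is lam^2 |G
  x|^2. The gradient bound makes f Lipschitz, which permits dominated convergence.\<close>

lemma second_order_poincare:
  fixes G :: "'a \<Rightarrow> 'a"
  assumes D: "\<And>x. (f has_derivative (\<lambda>h. G x \<bullet> h)) (at x)"
    and L: "\<And>x. norm (G x) \<le> L" and [measurable]: "G \<in> borel_measurable borel"
  shows "2 * residual + lam\<^sup>2 * (slope \<bullet> slope) \<le> lam\<^sup>2 * (\<integral>x. (norm (G x))\<^sup>2 \<partial>gauss_mu lam)"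
proof -
  interpret g: prob_space "gauss_mu lam :: 'a measure" by (rule prob_space_gauss_mu)
  interpret p: pair_prob_space "gauss_mu lam :: 'a measure" "gauss_mu lam :: 'a measure" ..
  let ?M = "gauss_mu lam \<Otimes>\<^sub>M gauss_mu lam :: ('a \<times> 'a) measure"
  have L0: "L \<ge> 0" using L[of 0] norm_ge_zero order_trans by blast
  have lip: "\<bar>f x - f y\<bar> \<le> L * norm (x - y)" for x y
  proof -
    have "norm (f x - f y) \<le> L * norm (x - y)"
    proof (rule differentiable_bound[of UNIV])
      show "(f has_derivative (\<lambda>h. G z \<bullet> h)) (at z within UNIV)" for z using D by simp
      show "onorm (\<lambda>h. G z \<bullet> h) \<le> L" for z
      proof (rule onorm_bound[OF L0])
        show "norm (G z \<bullet> h) \<le> L * norm h" for h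
          using Cauchy_Schwarz_ineq2[of "G z" h] mult_right_mono[OF L[of z] norm_ge_zero[of h]] by simp
      qed
    qed auto
    then show ?thesis by simp
  qed
  \<comment> \<open>The noise level e = sqrt(1 - t^2) is the parameter, since sqrt(1 - e^2) x + e w
    is differentiable at e = 0 with velocity w. The shift by 2 keeps \<open>e n\<close> below 1 and
    hence \<open>t n\<close> positive.\<close>
  define e where "e n = 1 / (real n + 2)" for n :: nat
  define t where "t n = sqrt (1 - (e n)\<^sup>2)" for n
  have e: "0 < e n" "e n < 1" for n by (auto simp: e_def)
  have e0: "e \<longlonglongrightarrow> 0"
    unfolding e_def[abs_def] using LIMSEQ_ignore_initial_segment[OF lim_1_over_n[where 'a=real], of 2] by (simp add: add.commute)
  have e2: "(e n)\<^sup>2 < 1" "0 < (e n)\<^sup>2" for n using e[of n] by (auto simp: abs_square_less_1)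
  have t: "0 < t n" "t n < 1" "1 - (t n)\<^sup>2 = (e n)\<^sup>2" "sqrt (1 - (t n)\<^sup>2) = e n" for n
    using e[of n] e2[of n] by (auto simp: t_def)
  \<comment> \<open>The drift (1 - t) x is thus at most of order e, so the difference quotients are
    dominated by a multiple of |x| + |w|.\<close>
  have te: "1 - t n \<le> e n" for n
  proof -
    have "1 - t n \<le> (1 - t n) * (1 + t n)" using t(1,2)[of n] by (simp add: mult_le_cancel_left1)
    also have "\<dots> = (e n)\<^sup>2" using t(3)[of n] by (simp add: algebra_simps power2_eq_square)
    also have "\<dots> \<le> e n" using e[of n] by (simp add: power2_eq_square)
    finally show ?thesis .
  qed
  define s where "s n p = ((f (fst p) - f (t n *\<^sub>R fst p + e n *\<^sub>R snd p)) / e n)\<^sup>2" for n and p :: "'a \<times> 'a"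
  have fst2: "integrable ?M (\<lambda>p. (norm (fst p))\<^sup>2)"
    by (rule integrable_gauss_mu_fst[OF integrable_norm_sq])
  have snd2: "integrable ?M (\<lambda>p. (norm (snd p))\<^sup>2)"
    using p.integrable_product_swap[OF fst2] by (simp add: case_prod_beta')
  have lim: "(\<lambda>n. integral\<^sup>L ?M (s n)) \<longlonglongrightarrow> (\<integral>p. (G (fst p) \<bullet> snd p)\<^sup>2 \<partial>?M)"
  proof (rule integral_dominated_convergence[where w="\<lambda>p. 2 * L\<^sup>2 * ((norm (fst p))\<^sup>2 + (norm (snd p))\<^sup>2)"])
    show "(\<lambda>p. (G (fst p) \<bullet> snd p)\<^sup>2) \<in> borel_measurable ?M" by measurable
    show "s n \<in> borel_measurable ?M" for n unfolding s_def by measurable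
    show "integrable ?M (\<lambda>p. 2 * L\<^sup>2 * ((norm (fst p))\<^sup>2 + (norm (snd p))\<^sup>2))"
      using fst2 snd2 by simp
    show "AE p in ?M. norm (s n p) \<le> 2 * L\<^sup>2 * ((norm (fst p))\<^sup>2 + (norm (snd p))\<^sup>2)" for n
    proof (intro AE_I2)
      fix p :: "'a \<times> 'a"
      obtain x w where p: "p = (x, w)" by force
      have "norm (x - (t n *\<^sub>R x + e n *\<^sub>R w)) = norm ((1 - t n) *\<^sub>R x - e n *\<^sub>R w)"
        by (simp add: algebra_simps)
      also have "\<dots> \<le> (1 - t n) * norm x + e n * norm w"
        using norm_triangle_ineq4[of "(1 - t n) *\<^sub>R x" "e n *\<^sub>R w"] t(2)[of n] e(1)[of n] by simp
      also have "\<dots> \<le> e n * (norm x + norm w)"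
        using mult_right_mono[OF te[of n] norm_ge_zero[of x]] by (simp add: algebra_simps)
      finally have d: "norm (x - (t n *\<^sub>R x + e n *\<^sub>R w)) \<le> e n * (norm x + norm w)" .
      have "\<bar>f x - f (t n *\<^sub>R x + e n *\<^sub>R w)\<bar> \<le> L * (e n * (norm x + norm w))"
        using lip order_trans mult_left_mono[OF d L0] by blast
      then have "\<bar>(f x - f (t n *\<^sub>R x + e n *\<^sub>R w)) / e n\<bar> \<le> L * (norm x + norm w)"
        using e(1)[of n] by (simp add: abs_divide pos_divide_le_eq mult_ac)
      then have "s n p \<le> L\<^sup>2 * (norm x + norm w)\<^sup>2"
        using abs_le_square_iff[of "(f x - f (t n *\<^sub>R x + e n *\<^sub>R w)) / e n" "L * (norm x + norm w)"] L0
        by (simp add: s_def p power_mult_distrib abs_mult)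
      also have "\<dots> \<le> L\<^sup>2 * (2 * ((norm x)\<^sup>2 + (norm w)\<^sup>2))"
        using sum_squares_bound[of "norm x" "norm w"] by (intro mult_left_mono) (auto simp: power2_sum)
      finally have "s n p \<le> 2 * L\<^sup>2 * ((norm x)\<^sup>2 + (norm w)\<^sup>2)" by (simp add: algebra_simps)
      moreover have "norm (s n p) = s n p" by (simp add: s_def)
      ultimately show "norm (s n p) \<le> 2 * L\<^sup>2 * ((norm (fst p))\<^sup>2 + (norm (snd p))\<^sup>2)"
        by (simp only: p fst_conv snd_conv)
    qed
    show "AE p in ?M. (\<lambda>n. s n p) \<longlonglongrightarrow> (G (fst p) \<bullet> snd p)\<^sup>2"
    proof (intro AE_I2)
      fix p :: "'a \<times> 'a"
      obtain x w where p: "p = (x, w)" by force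
      define h where "h r = sqrt (1 - r\<^sup>2) *\<^sub>R x + r *\<^sub>R w" for r :: real
      \<comment> \<open>The coefficient of x is stationary at r = 0, so x does not contribute to the
        velocity of the curve.\<close>
      have "((\<lambda>r::real. sqrt (1 - r\<^sup>2)) has_real_derivative 0) (at 0)"
        by (auto intro!: derivative_eq_intros)
      then have "(h has_vector_derivative w) (at 0)"
        unfolding h_def by (auto intro!: derivative_eq_intros simp: has_real_derivative_iff_has_vector_derivative)
      then have "(h has_derivative (\<lambda>r. r *\<^sub>R w)) (at 0)" by (simp add: has_vector_derivative_def)
      moreover have "(f has_derivative (\<lambda>k. G x \<bullet> k)) (at (h 0))" using D[of x] by (simp add: h_def)
      ultimately have "((\<lambda>r. f (h r)) has_derivative (\<lambda>r. G x \<bullet> (r *\<^sub>R w))) (at 0)"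
        by (rule has_derivative_compose)
      then have "((\<lambda>r. f (h r)) has_real_derivative (G x \<bullet> w)) (at 0)"
        by (simp add: has_field_derivative_def mult_commute_abs)
      then have "((\<lambda>r. (f (h r) - f (h 0)) / r) \<longlongrightarrow> G x \<bullet> w) (at 0)"
        by (simp add: has_field_derivative_iff)
      moreover have "filterlim e (at 0) sequentially"
        using e0 e(1) by (auto simp: filterlim_at less_imp_neq[symmetric] intro!: always_eventually)
      ultimately have "(\<lambda>n. (f (h (e n)) - f (h 0)) / e n) \<longlonglongrightarrow> G x \<bullet> w"
        by (rule filterlim_compose)
      then have "(\<lambda>n. ((f (h (e n)) - f (h 0)) / e n)\<^sup>2) \<longlonglongrightarrow> (G x \<bullet> w)\<^sup>2"
        by (rule tendsto_power)
      moreover have "((f (h (e n)) - f (h 0)) / e n)\<^sup>2 = s n p" for n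
        by (simp add: s_def h_def p t_def power_divide power2_commute)
      ultimately show "(\<lambda>n. s n p) \<longlonglongrightarrow> (G (fst p) \<bullet> snd p)\<^sup>2" by (simp add: p)
    qed
  qed
  have "integral\<^sup>L ?M (s n) = 2 * ((\<integral>x. (f x)\<^sup>2 \<partial>gauss_mu lam) - corr (t n)) / (e n)\<^sup>2" for n
  proof -
    have "s n = (\<lambda>p. (case p of (x, w) \<Rightarrow> (f x - f (t n *\<^sub>R x + sqrt (1 - (t n)\<^sup>2) *\<^sub>R w))\<^sup>2) / (e n)\<^sup>2)"
      unfolding t(4) by (auto simp: s_def power_divide)
    then show ?thesis
      using corr_eq_increments[of "t n"] t(1,2)[of n] by simp
  qed
  moreover have "2 * ((\<integral>x. (f x)\<^sup>2 \<partial>gauss_mu lam) - corr (t n)) / (e n)\<^sup>2 \<ge> 2 * residual + lam\<^sup>2 * (slope \<bullet> slope)" for n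
  proof -
    define Q where "Q = lam\<^sup>2 * (slope \<bullet> slope)"
    have Q: "Q \<ge> 0" by (simp add: Q_def)
    have "corr (t n) - mean\<^sup>2 - t n * Q \<le> (t n)\<^sup>2 * residual"
      using residual_corr_le[OF t(1,2)] by (simp add: residual_corr_def Q_def mult_ac)
    moreover have "residual = (\<integral>x. (f x)\<^sup>2 \<partial>gauss_mu lam) - mean\<^sup>2 - Q"
      using residual_eq by (simp add: Q_def)
    moreover have "(1 - (t n)\<^sup>2) * residual + (1 - t n) * Q = residual + Q - (t n)\<^sup>2 * residual - t n * Q"
      by (simp add: left_diff_distrib)
    ultimately have "(\<integral>x. (f x)\<^sup>2 \<partial>gauss_mu lam) - corr (t n) \<ge> (1 - (t n)\<^sup>2) * residual + (1 - t n) * Q"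
      by linarith
    \<comment> \<open>The linear part has eigenvalue t, not t^2; its gap 1 - t is at least half of 1
      - t^2 = e^2 because (1 - t)^2 >= 0.\<close>
    moreover have "(1 - t n) * Q \<ge> (e n)\<^sup>2 / 2 * Q"
    proof (rule mult_right_mono[OF _ Q])
      have "0 \<le> (1 - t n)\<^sup>2" by simp
      then show "(e n)\<^sup>2 / 2 \<le> 1 - t n" 
        using t(3)[of n] by (simp add: power2_diff)
    qed
    ultimately have "2 * ((\<integral>x. (f x)\<^sup>2 \<partial>gauss_mu lam) - corr (t n)) \<ge> (2 * residual + Q) * (e n)\<^sup>2"
      unfolding t(3) by (simp add: algebra_simps)
    then show ?thesis using e2[of n] by (simp add: pos_le_divide_eq Q_def)
  qed
  ultimately have le: "2 * residual + lam\<^sup>2 * (slope \<bullet> slope) \<le> integral\<^sup>L ?M (s n)" for n by simp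
  have "2 * residual + lam\<^sup>2 * (slope \<bullet> slope) \<le> (\<integral>p. (G (fst p) \<bullet> snd p)\<^sup>2 \<partial>?M)"
    by (rule LIMSEQ_le_const[OF lim]) (use le in auto)
  also have "\<dots> = (\<integral>x. (\<integral>w. (G x \<bullet> w)\<^sup>2 \<partial>gauss_mu lam) \<partial>gauss_mu lam)"
  proof -
    have "integrable ?M (\<lambda>p. (G (fst p) \<bullet> snd p)\<^sup>2)"
    proof (rule Bochner_Integration.integrable_bound)
      show "integrable ?M (\<lambda>p. L\<^sup>2 * (norm (snd p))\<^sup>2)" using snd2 by simp
      show "AE p in ?M. norm ((G (fst p) \<bullet> snd p)\<^sup>2) \<le> norm (L\<^sup>2 * (norm (snd p))\<^sup>2)"
      proof (intro AE_I2)
        fix p :: "'a \<times> 'a"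
        have "\<bar>G (fst p) \<bullet> snd p\<bar> \<le> L * norm (snd p)"
          using Cauchy_Schwarz_ineq2[of "G (fst p)" "snd p"] mult_right_mono[OF L[of "fst p"] norm_ge_zero[of "snd p"]] by simp
        from power_mono[OF this, of 2] show "norm ((G (fst p) \<bullet> snd p)\<^sup>2) \<le> norm (L\<^sup>2 * (norm (snd p))\<^sup>2)"
          by (simp add: power_mult_distrib)
      qed
    qed measurable
    from p.integral_fst'[OF this] show ?thesis by simp
  qed
  also have "\<dots> = (\<integral>x. lam\<^sup>2 * (norm (G x))\<^sup>2 \<partial>gauss_mu lam)"
  proof -
    have "(G x \<bullet> w)\<^sup>2 = (w \<bullet> G x) * (w \<bullet> G x)" for x w
      by (simp add: power2_eq_square inner_commute)
    then show ?thesis by (simp add: integral_inner_mult power2_norm_eq_inner)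
  qed
  also have "\<dots> = lam\<^sup>2 * (\<integral>x. (norm (G x))\<^sup>2 \<partial>gauss_mu lam)" by simp
  finally show ?thesis .
qed

end

section \<open>Gradients and uniform bounds of test functions\<close>

lemma smooth_differentiable: "smooth f \<Longrightarrow> f differentiable (at x)"
  by (erule smooth.cases) auto

lemma smooth_frechet_derivative:
  "smooth f \<Longrightarrow> b \<in> Basis \<Longrightarrow> smooth (\<lambda>x. frechet_derivative f (at x) b)"
  by (erule smooth.cases) auto

lemma smooth_continuous_on: "smooth f \<Longrightarrow> continuous_on S f"
  using smooth_differentiable differentiable_imp_continuous_within continuous_at_imp_continuous_on by blast

lemma smooth_has_derivative_grad:
  assumes "smooth f"
  shows "(f has_derivative (\<lambda>h. grad f x \<bullet> h)) (at x)"
proof -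
  have d: "(f has_derivative frechet_derivative f (at x)) (at x)"
    using smooth_differentiable[OF assms] by (simp add: frechet_derivative_works)
  then have lin: "linear (frechet_derivative f (at x))" by (rule has_derivative_linear)
  have "frechet_derivative f (at x) h = grad f x \<bullet> h" for h
  proof -
    have "frechet_derivative f (at x) h = frechet_derivative f (at x) (\<Sum>b\<in>Basis. (h \<bullet> b) *\<^sub>R b)"
      by (simp add: euclidean_representation)
    also have "\<dots> = (\<Sum>b\<in>Basis. (h \<bullet> b) * frechet_derivative f (at x) b)"
      by (simp add: linear_sum[OF lin] linear_scale[OF lin])
    finally show ?thesis
      by (simp add: grad_def inner_sum_left) (simp add: inner_commute mult.commute)
  qed
  then have "frechet_derivative f (at x) = (\<lambda>h. grad f x \<bullet> h)" by (rule ext)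
  with d show ?thesis by simp
qed

lemma smooth_continuous_on_grad: "smooth f \<Longrightarrow> continuous_on S (grad f)"
  unfolding grad_def[abs_def]
  by (intro continuous_intros smooth_continuous_on smooth_frechet_derivative)

lemma test_fun_bounds:
  fixes f :: "'a::euclidean_space \<Rightarrow> real"
  assumes "test_fun f"
  obtains R B L where "R \<ge> 0" "\<And>x. norm x > R \<Longrightarrow> f x = 0" "\<And>x. \<bar>f x\<bar> \<le> B" "\<And>x. norm (grad f x) \<le> L"
proof -
  have sm: "smooth f" and "bounded (closure {x. f x \<noteq> 0})"
    using assms by (auto simp: test_fun_def compact_imp_bounded)
  then have "bounded {x. f x \<noteq> 0}" using bounded_subset closure_subset by blast
  then obtain R where R: "R > 0" "\<And>x. f x \<noteq> 0 \<Longrightarrow> norm x \<le> R"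
    by (auto simp: bounded_pos)
  have f0: "f x = 0" if "norm x > R" for x using R(2)[of x] that by force
  \<comment> \<open>The complement of the closed ball is open and f vanishes on it, so the
    derivative vanishes there as well.\<close>
  have g0: "grad f x = 0" if x: "norm x > R" for x
  proof -
    have "open (- cball (0::'a) R)" by auto
    moreover have "x \<in> - cball 0 R" using x by simp
    ultimately have "(f has_derivative (\<lambda>_. 0)) (at x)"
      using f0 by (intro has_derivative_transform_within_open[of "\<lambda>_. 0" _ x UNIV "- cball 0 R" f]) auto
    then have "(\<lambda>h. grad f x \<bullet> h) = (\<lambda>_. 0)"
      using smooth_has_derivative_grad[OF sm] has_derivative_unique by blast
    then show ?thesis by (metis inner_eq_zero_iff)
  qed
  have "compact (f ` cball 0 R)" "compact (grad f ` cball 0 R)"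
    by (auto intro!: compact_continuous_image smooth_continuous_on smooth_continuous_on_grad sm)
  then have "bounded (f ` cball 0 R)" "bounded (grad f ` cball 0 R)"
    by (auto intro: compact_imp_bounded)
  then obtain B L where "\<forall>y\<in>f ` cball 0 R. norm y \<le> B" "\<forall>y\<in>grad f ` cball 0 R. norm y \<le> L"
    unfolding bounded_iff by blast
  then have B: "\<And>x. norm x \<le> R \<Longrightarrow> \<bar>f x\<bar> \<le> B" and L: "\<And>x. norm x \<le> R \<Longrightarrow> norm (grad f x) \<le> L"
    by auto
  have "B \<ge> 0" using B[of 0] R(1) by auto
  have "L \<ge> 0" using order_trans[OF norm_ge_zero L[of 0]] R(1) by simp
  show ?thesis
  proof (rule that[of R B L])
    show "\<bar>f x\<bar> \<le> B" for x using B[of x] f0[of x] \<open>B \<ge> 0\<close> by (cases "norm x \<le> R") auto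
    show "norm (grad f x) \<le> L" for x using L[of x] g0[of x] \<open>L \<ge> 0\<close> by (cases "norm x \<le> R") auto
  qed (use R f0 in auto)
qed

section \<open>Passage to the limit\<close>

text \<open>Integrated form of (a + d)^2 <= (1 + e) a^2 + (1 + 1 / e) d^2. It replaces the L^2
  triangle inequality, stays meaningful for infinite integrals, and its main factor can be brought
  as close to 1 as desired.\<close>

lemma nn_integral_square_le_split:
  fixes u v :: "'a \<Rightarrow> 'b::euclidean_space"
  assumes [measurable]: "u \<in> borel_measurable M" "v \<in> borel_measurable M" and e: "e > 0"
  shows "(\<integral>\<^sup>+ x. ennreal ((norm (u x))\<^sup>2) \<partial>M) \<le>
    ennreal (1 + e) * (\<integral>\<^sup>+ x. ennreal ((norm (v x))\<^sup>2) \<partial>M) + ennreal (1 + 1 / e) * (\<integral>\<^sup>+ x. ennreal ((norm (v x - u x))\<^sup>2) \<partial>M)"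
proof -
  have "(norm (u x))\<^sup>2 \<le> (1 + e) * (norm (v x))\<^sup>2 + (1 + 1 / e) * (norm (v x - u x))\<^sup>2" for x
  proof -
    define a d where "a = norm (v x)" and "d = norm (v x - u x)"
    have "norm (u x) \<le> a + d"
      using norm_triangle_ineq4[of "v x" "v x - u x"] by (simp add: a_def d_def)
    then have "(norm (u x))\<^sup>2 \<le> (a + d)\<^sup>2" by (intro power_mono) auto
    also have "\<dots> \<le> (1 + e) * a\<^sup>2 + (1 + 1 / e) * d\<^sup>2"
    proof -
      have "0 \<le> (e * a - d)\<^sup>2 / e" using e by simp
      also have "\<dots> = e * a\<^sup>2 + d\<^sup>2 / e - 2 * a * d" using e by (simp add: power2_eq_square field_simps)
      finally show ?thesis by (simp add: power2_sum algebra_simps)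
    qed
    finally show ?thesis by (simp add: a_def d_def)
  qed
  then have "(\<integral>\<^sup>+ x. ennreal ((norm (u x))\<^sup>2) \<partial>M) \<le>
    (\<integral>\<^sup>+ x. ennreal (1 + e) * ennreal ((norm (v x))\<^sup>2) + ennreal (1 + 1 / e) * ennreal ((norm (v x - u x))\<^sup>2) \<partial>M)"
    using e by (intro nn_integral_mono) (simp add: ennreal_leI flip: ennreal_mult ennreal_plus)
  also have "\<dots> = ennreal (1 + e) * (\<integral>\<^sup>+ x. ennreal ((norm (v x))\<^sup>2) \<partial>M) + ennreal (1 + 1 / e) * (\<integral>\<^sup>+ x. ennreal ((norm (v x - u x))\<^sup>2) \<partial>M)"
    by (subst nn_integral_add) (auto simp: nn_integral_cmult)
  finally show ?thesis .
qed

text \<open>The square is there because the splitting estimate will be applied on both sides: from u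
  to a test function and from its gradient to g.\<close>

lemma ennreal_le_of_le_one_plus:
  fixes I D :: ennreal
  assumes "\<And>e. e > 0 \<Longrightarrow> I \<le> ennreal ((1 + e)\<^sup>2) * D"
  shows "I \<le> D"
proof (cases D)
  case (real d)
  \<comment> \<open>The single value e = 1 shows that I is finite when D is, so the limit e -> 0 can
    be taken in the reals.\<close>
  have "I \<le> ennreal 4 * D" using assms[of 1] by simp
  then obtain i where i: "I = ennreal i" "i \<ge> 0" 
    using real by (cases I) (auto simp: top_unique ennreal_mult_eq_top_iff)
  have le: "i \<le> (1 + e)\<^sup>2 * d" if "e > 0" for e
    using assms[OF that] i real by (simp flip: ennreal_mult)
  have "((\<lambda>e. (1 + e)\<^sup>2 * d) \<longlongrightarrow> (1 + 0)\<^sup>2 * d) (at_right 0)" by (intro tendsto_intros)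
  then have "i \<le> (1 + 0)\<^sup>2 * d"
    by (rule tendsto_lowerbound) (auto simp: eventually_at_right_field le intro!: exI[of _ 1])
  then show ?thesis using i real by (simp add: ennreal_leI)
qed simp

context gaussian begin

text \<open>The pair is the mean and the slope: the integrals are then residual + lam^2 |slope|^2
  and residual, whose sum is the left side of the bound for cut-off functions.\<close>

lemma test_fun_inequality:
  fixes f :: "'a::euclidean_space \<Rightarrow> real"
  assumes "test_fun f"
  shows "\<exists>c d. (\<integral>\<^sup>+ x. ennreal ((f x - c)\<^sup>2) \<partial>gauss_mu lam) + (\<integral>\<^sup>+ x. ennreal ((f x - c - d \<bullet> x)\<^sup>2) \<partial>gauss_mu lam)
     \<le> ennreal (lam\<^sup>2) * dirichlet lam (grad f)"
proof -
  have sm: "smooth f" using assms by (simp add: test_fun_def)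
  obtain R B L where b: "R \<ge> 0" "\<And>x. norm x > R \<Longrightarrow> f x = 0" "\<And>x. \<bar>f x\<bar> \<le> B" "\<And>x. norm (grad f x) \<le> L"
    using test_fun_bounds[OF assms] by blast
  have fm[measurable]: "f \<in> borel_measurable borel"
    by (intro borel_measurable_continuous_onI smooth_continuous_on sm)
  have gm[measurable]: "grad f \<in> borel_measurable borel"
    by (intro borel_measurable_continuous_onI smooth_continuous_on_grad sm)
  interpret c: gaussian_cutoff lam f B R
    using b fm by unfold_locales auto
  interpret g: prob_space "gauss_mu lam :: 'a measure" by (rule prob_space_gauss_mu)
  note ineq = c.second_order_poincare[OF smooth_has_derivative_grad[OF sm] b(4) gm]
  have fm: "(\<integral>x. f x \<partial>gauss_mu lam) = c.mean" by (simp add: c.mean_def)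
  have fl: "(\<integral>x. f x * (x \<bullet> v) \<partial>gauss_mu lam) = 1 * lam\<^sup>2 * (c.slope \<bullet> v)" for v
    by (simp add: c.integral_mult_inner)
  have i1: "integrable (gauss_mu lam) (\<lambda>x. (f x - c.mean - c.slope \<bullet> x)\<^sup>2)"
    using c.integral_affine_residuals(1)[OF c.f_measurable c.f_measurable b(3) b(3) fm fm fl fl]
    by (simp add: power2_eq_square)
  have if2: "integrable (gauss_mu lam) (\<lambda>x. (f x)\<^sup>2)"
  proof (rule integrable_gauss_mu_bounded)
    show "\<bar>(f x)\<^sup>2\<bar> \<le> B\<^sup>2" for x using power_mono[OF b(3), of x 2] by simp
  qed simp
  have e: "(f x - c.mean)\<^sup>2 = (f x)\<^sup>2 - 2 * c.mean * f x + c.mean\<^sup>2" for x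
    by (simp add: power2_diff algebra_simps)
  have i2: "integrable (gauss_mu lam) (\<lambda>x. (f x - c.mean)\<^sup>2)"
    unfolding e using if2 c.integrable_f by simp
  have I2: "(\<integral>x. (f x - c.mean)\<^sup>2 \<partial>gauss_mu lam) = c.residual + lam\<^sup>2 * (c.slope \<bullet> c.slope)"
    unfolding e using if2 c.integrable_f g.prob_space fm
    by (simp add: c.residual_eq power2_eq_square)
  have i3: "integrable (gauss_mu lam) (\<lambda>x. (norm (grad f x))\<^sup>2)"
  proof (rule integrable_gauss_mu_bounded)
    show "\<bar>(norm (grad f x))\<^sup>2\<bar> \<le> L\<^sup>2" for x using power_mono[OF b(4), of x 2] by simp
  qed simp
  have "(\<integral>\<^sup>+ x. ennreal ((f x - c.mean)\<^sup>2) \<partial>gauss_mu lam) + (\<integral>\<^sup>+ x. ennreal ((f x - c.mean - c.slope \<bullet> x)\<^sup>2) \<partial>gauss_mu lam)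
      = ennreal (c.residual + lam\<^sup>2 * (c.slope \<bullet> c.slope)) + ennreal c.residual"
    using i1 i2 I2 by (simp add: nn_integral_eq_integral c.residual_def)
  also have "\<dots> = ennreal (2 * c.residual + lam\<^sup>2 * (c.slope \<bullet> c.slope))"
    by (subst ennreal_plus[symmetric]) (auto simp: c.residual_def)
  also have "\<dots> \<le> ennreal (lam\<^sup>2 * (\<integral>x. (norm (grad f x))\<^sup>2 \<partial>gauss_mu lam))"
    using ineq by (rule ennreal_leI)
  also have "\<dots> = ennreal (lam\<^sup>2) * dirichlet lam (grad f)"
    unfolding dirichlet_def using i3 by (simp add: nn_integral_eq_integral ennreal_mult)
  finally show ?thesis by blast
qed

text \<open>The affine function belonging to the n-th test function is a competitor for u at that
  same n, so the infimum is bounded for each n and convergence of these affine functions never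
  enters.\<close>

lemma rhs_inf_le_dirichlet:
  fixes u :: "'a::euclidean_space \<Rightarrow> real"
  assumes "X_lam0 lam u g"
  shows "rhs_inf lam u \<le> dirichlet lam g"
proof -
  let ?\<mu> = "gauss_mu lam :: 'a measure"
  obtain \<phi> where um[measurable]: "u \<in> borel_measurable borel" and gm[measurable]: "g \<in> borel_measurable borel"
    and tf: "\<And>n. test_fun (\<phi> n)"
    and \<delta>: "(\<lambda>n. \<integral>\<^sup>+ x. ennreal ((\<phi> n x - u x)\<^sup>2) \<partial>?\<mu>) \<longlonglongrightarrow> 0"
    and \<eta>: "(\<lambda>n. \<integral>\<^sup>+ x. ennreal ((norm (grad (\<phi> n) x - g x))\<^sup>2) \<partial>?\<mu>) \<longlonglongrightarrow> 0"
    using assms by (auto simp: X_lam0_def)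
  define I where "I = (INF cd \<in> (UNIV :: (real \<times> 'a) set).
        \<integral>\<^sup>+ x. ennreal ((u x - fst cd)\<^sup>2 + (u x - fst cd - snd cd \<bullet> x)\<^sup>2) \<partial>?\<mu>)"
  have sm: "smooth (\<phi> n)" for n using tf by (simp add: test_fun_def)
  have [measurable]: "\<phi> n \<in> borel_measurable borel" "grad (\<phi> n) \<in> borel_measurable borel" for n
    by (auto intro!: borel_measurable_continuous_onI smooth_continuous_on smooth_continuous_on_grad sm)
  have "I \<le> ennreal ((1 + e)\<^sup>2) * (ennreal (lam\<^sup>2) * dirichlet lam g)" if e: "e > 0" for e
  proof (rule LIMSEQ_le_const)
    let ?\<delta> = "\<lambda>n. \<integral>\<^sup>+ x. ennreal ((\<phi> n x - u x)\<^sup>2) \<partial>?\<mu>"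
    let ?\<eta> = "\<lambda>n. \<integral>\<^sup>+ x. ennreal ((norm (grad (\<phi> n) x - g x))\<^sup>2) \<partial>?\<mu>"
    \<comment> \<open>The error terms carry the possibly large factor 1 + 1 / e, but e is fixed
      while n grows; they vanish and the factor (1 + e)^2 remains.\<close>
    let ?b = "\<lambda>n. ennreal (1 + e) * (ennreal (lam\<^sup>2) * (ennreal (1 + e) * dirichlet lam g + ennreal (1 + 1 / e) * ?\<eta> n))
        + (ennreal (1 + 1 / e) * ?\<delta> n + ennreal (1 + 1 / e) * ?\<delta> n)"
    have "?b \<longlonglongrightarrow> ennreal (1 + e) * (ennreal (lam\<^sup>2) * (ennreal (1 + e) * dirichlet lam g + ennreal (1 + 1 / e) * 0))
        + (ennreal (1 + 1 / e) * 0 + ennreal (1 + 1 / e) * 0)"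
      by (intro tendsto_add ennreal_tendsto_cmult tendsto_const \<delta> \<eta>) auto
    moreover have "ennreal (1 + e) * (ennreal (lam\<^sup>2) * (ennreal (1 + e) * dirichlet lam g))
        = ennreal ((1 + e)\<^sup>2) * (ennreal (lam\<^sup>2) * dirichlet lam g)"
      using e by (simp add: power2_eq_square ennreal_mult mult_ac)
    ultimately show "?b \<longlonglongrightarrow> ennreal ((1 + e)\<^sup>2) * (ennreal (lam\<^sup>2) * dirichlet lam g)" by simp
    show "\<exists>N. \<forall>n\<ge>N. I \<le> ?b n"
    proof (intro exI allI impI)
      fix n :: nat
      obtain c d where cd: "(\<integral>\<^sup>+ x. ennreal ((\<phi> n x - c)\<^sup>2) \<partial>?\<mu>) + (\<integral>\<^sup>+ x. ennreal ((\<phi> n x - c - d \<bullet> x)\<^sup>2) \<partial>?\<mu>)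
         \<le> ennreal (lam\<^sup>2) * dirichlet lam (grad (\<phi> n))"
        using test_fun_inequality[OF tf] by blast
      have s1: "(\<integral>\<^sup>+ x. ennreal ((u x - c)\<^sup>2) \<partial>?\<mu>) \<le>
          ennreal (1 + e) * (\<integral>\<^sup>+ x. ennreal ((\<phi> n x - c)\<^sup>2) \<partial>?\<mu>) + ennreal (1 + 1 / e) * ?\<delta> n"
        using nn_integral_square_le_split[of "\<lambda>x. u x - c" ?\<mu> "\<lambda>x. \<phi> n x - c" e] e by simp
      have s2: "(\<integral>\<^sup>+ x. ennreal ((u x - c - d \<bullet> x)\<^sup>2) \<partial>?\<mu>) \<le>
          ennreal (1 + e) * (\<integral>\<^sup>+ x. ennreal ((\<phi> n x - c - d \<bullet> x)\<^sup>2) \<partial>?\<mu>) + ennreal (1 + 1 / e) * ?\<delta> n"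
        using nn_integral_square_le_split[of "\<lambda>x. u x - c - d \<bullet> x" ?\<mu> "\<lambda>x. \<phi> n x - c - d \<bullet> x" e] e by simp
      have s3: "dirichlet lam (grad (\<phi> n)) \<le> ennreal (1 + e) * dirichlet lam g + ennreal (1 + 1 / e) * ?\<eta> n"
        unfolding dirichlet_def
        using nn_integral_square_le_split[of "grad (\<phi> n)" ?\<mu> g e] e by (simp add: norm_minus_commute)
      have "I \<le> (\<integral>\<^sup>+ x. ennreal ((u x - c)\<^sup>2 + (u x - c - d \<bullet> x)\<^sup>2) \<partial>?\<mu>)"
        unfolding I_def by (rule INF_lower2[of "(c, d)"]) auto
      also have "\<dots> = (\<integral>\<^sup>+ x. ennreal ((u x - c)\<^sup>2) \<partial>?\<mu>) + (\<integral>\<^sup>+ x. ennreal ((u x - c - d \<bullet> x)\<^sup>2) \<partial>?\<mu>)"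
        by (subst nn_integral_add[symmetric]) auto
      also have "\<dots> \<le> ennreal (1 + e) * ((\<integral>\<^sup>+ x. ennreal ((\<phi> n x - c)\<^sup>2) \<partial>?\<mu>) + (\<integral>\<^sup>+ x. ennreal ((\<phi> n x - c - d \<bullet> x)\<^sup>2) \<partial>?\<mu>))
          + (ennreal (1 + 1 / e) * ?\<delta> n + ennreal (1 + 1 / e) * ?\<delta> n)"
        using add_mono[OF s1 s2] by (simp add: distrib_left ac_simps)
      also have "\<dots> \<le> ?b n"
        using order_trans[OF cd mult_left_mono[OF s3, of "ennreal (lam\<^sup>2)"]] by (intro add_mono mult_left_mono) auto
      finally show "I \<le> ?b n" .
    qed
  qed
  then have "I \<le> ennreal (lam\<^sup>2) * dirichlet lam g" by (rule ennreal_le_of_le_one_plus)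
  then have "ennreal (1 / lam\<^sup>2) * I \<le> ennreal (1 / lam\<^sup>2) * (ennreal (lam\<^sup>2) * dirichlet lam g)"
    by (intro mult_left_mono) auto
  also have "\<dots> = dirichlet lam g"
    using lam by (simp add: mult.assoc[symmetric] flip: ennreal_mult)
  finally show ?thesis by (simp add: rhs_inf_def I_def)
qed

end

section \<open>Equality for quadratic functions\<close>

text \<open>The powers of 1 / s are included so that the linear span of the family is closed under
  differentiation.\<close>

definition bump :: "nat \<Rightarrow> real \<Rightarrow> real" where
  "bump k s = (if s > 0 then exp (- (1 / s)) / s ^ k else 0)"

lemma bump_nonneg[simp]: "0 \<le> bump k s"
  by (simp add: bump_def)

lemma borel_measurable_bump[measurable]: "bump k \<in> borel_measurable borel"
  unfolding bump_def[abs_def] by measurable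

lemma tendsto_bump_0: "(bump k \<longlongrightarrow> 0) (at 0)"
proof (rule filterlim_split_at)
  have "((\<lambda>s::real. (inverse s) ^ k / exp (inverse s)) \<longlongrightarrow> 0) (at_right 0)"
    by (rule filterlim_compose[OF tendsto_power_div_exp_0 filterlim_inverse_at_top_right])
  then show "(bump k \<longlongrightarrow> 0) (at_right 0)"
    by (rule Lim_transform_eventually)
       (auto simp: eventually_at_right_field bump_def exp_minus field_simps power_inverse intro!: exI[of _ 1])
  have "\<forall>\<^sub>F s in at_left 0. 0 = bump k s"
    by (auto simp: eventually_at_left_field bump_def intro!: exI[of _ "-1"])
  then show "(bump k \<longlongrightarrow> 0) (at_left 0)"
    by (rule Lim_transform_eventually[OF tendsto_const])
qed

lemma DERIV_bump: "(bump k has_real_derivative (bump (k + 2) s - k * bump (k + 1) s)) (at s)"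
proof -
  consider "s > 0" | "s < 0" | "s = 0" by linarith
  then show ?thesis
  proof cases
    case 1
    \<comment> \<open>Writing the power of t through ln leaves a single exponential to
      differentiate.\<close>
    have ex: "exp (- (1 / t) - k * ln t) = bump k t" if "t > 0" for t
      using that by (simp add: bump_def exp_diff exp_of_nat_mult)
    have d: "((\<lambda>t. exp (- (1 / t) - k * ln t)) has_real_derivative (1 / s\<^sup>2 - k / s) * exp (- (1 / s) - k * ln s)) (at s)"
      using 1 by (auto intro!: derivative_eq_intros simp: field_simps power2_eq_square)
    have v: "(1 / s\<^sup>2 - k / s) * exp (- (1 / s) - k * ln s) = bump (k + 2) s - k * bump (k + 1) s"
      unfolding ex[OF 1] using 1 by (simp add: bump_def field_simps power2_eq_square)
    have ev: "\<forall>\<^sub>F t in nhds s. exp (- (1 / t) - k * ln t) = bump k t"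
      using eventually_nhds_in_open[of "{0<..}" s] 1 by (auto elim!: eventually_mono simp: ex)
    show ?thesis by (rule DERIV_cong_ev[OF refl ev v, THEN iffD1, OF d])
  next
    case 2
    have d: "((\<lambda>s. 0) has_real_derivative (bump (k + 2) s - k * bump (k + 1) s)) (at s)"
      using 2 by (auto simp: bump_def)
    have ev: "\<forall>\<^sub>F t in nhds s. 0 = bump k t"
      using eventually_nhds_in_open[of "{..<0}" s] 2 by (auto elim!: eventually_mono simp: bump_def)
    show ?thesis by (rule DERIV_cong_ev[OF refl ev refl, THEN iffD1, OF d])
  next
    case 3
    \<comment> \<open>At 0 the difference quotient merely raises the index, so the derivative there
      is the limit already computed.\<close>
    have "bump (k + 1) = (\<lambda>h. (bump k h - bump k 0) / (h - 0))" by (auto simp: bump_def fun_eq_iff)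
    from tendsto_bump_0[of "k + 1", unfolded this]
    have "(bump k has_real_derivative 0) (at 0)"
      by (simp add: has_field_derivative_iff)
    then show ?thesis using 3 by (simp add: bump_def)
  qed
qed

text \<open>As \<open>bump 0 1\<close> is exp(-1), the factor exp 1 normalises the cutoff to the
  value 1 at s = 1, the argument it has at the origin.\<close>

lemma bump_0_le: "s \<le> 1 \<Longrightarrow> exp 1 * bump 0 s \<le> 1"
  by (auto simp: bump_def field_simps simp flip: exp_add)

text \<open>\<open>bump 2\<close> is the derivative of \<open>bump 0\<close>; the bound is exp y >=
  y^2 / 2 at y = 1 / s.\<close>

lemma bump_2_le: "bump 2 s \<le> 2"
proof (cases "s > 0")
  case True
  have "(1 / s)\<^sup>2 / 2 \<le> exp (1 / s)"
    using exp_lower_Taylor_quadratic[of "1 / s"] True by (smt (verit) divide_pos_pos)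
  then show ?thesis using True by (simp add: bump_def exp_minus field_simps)
qed (simp add: bump_def)

text \<open>An algebra of functions that is closed under directional derivatives, hence consists of smooth functions.\<close>
inductive bump_poly :: "real \<Rightarrow> ('a::euclidean_space \<Rightarrow> real) \<Rightarrow> bool" for c where
  const: "bump_poly c (\<lambda>_. a)"
| inner: "bump_poly c (\<lambda>x. x \<bullet> v)"
| bump: "bump_poly c (\<lambda>x. bump k (1 - c * (x \<bullet> x)))"
| add: "bump_poly c f \<Longrightarrow> bump_poly c g \<Longrightarrow> bump_poly c (\<lambda>x. f x + g x)"
| mult: "bump_poly c f \<Longrightarrow> bump_poly c g \<Longrightarrow> bump_poly c (\<lambda>x. f x * g x)"

lemma has_derivative_bump_radial:
  "((\<lambda>x::'a::euclidean_space. bump k (1 - c * (x \<bullet> x))) has_derivative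
     (\<lambda>h. (bump (k + 2) (1 - c * (x \<bullet> x)) - k * bump (k + 1) (1 - c * (x \<bullet> x))) * (- 2 * c * (x \<bullet> h)))) (at x)"
proof -
  have 1: "((\<lambda>x::'a. 1 - c * (x \<bullet> x)) has_derivative (\<lambda>h. - 2 * c * (x \<bullet> h))) (at x)"
    by (auto intro!: derivative_eq_intros simp: inner_commute)
  show ?thesis
    using has_derivative_compose[OF 1 DERIV_bump[THEN has_field_derivative_imp_has_derivative]] by simp
qed

lemma bump_poly_derivative:
  "bump_poly c f \<Longrightarrow> \<exists>f'. (\<forall>x. (f has_derivative f' x) (at x)) \<and> (\<forall>b. bump_poly c (\<lambda>x. f' x b))"
proof (induction rule: bump_poly.induct)
  case (const a)
  then show ?case by (intro exI[of _ "\<lambda>_ _. 0"]) (auto intro: bump_poly.const)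
next
  case (inner v)
  then show ?case
    by (intro exI[of _ "\<lambda>_ h. h \<bullet> v"]) (auto intro: bump_poly.const intro!: derivative_eq_intros)
next
  case (bump k)
  \<comment> \<open>The difference is written as a sum with the constant \<open>- real k\<close>,
    since the algebra is generated by sums and products.\<close>
  have "bump_poly c (\<lambda>x. (bump (k + 2) (1 - c * (x \<bullet> x)) + (- real k) * bump (k + 1) (1 - c * (x \<bullet> x))) * (- 2 * c * (x \<bullet> b)))" for b
    by (intro bump_poly.intros)
  then show ?case using has_derivative_bump_radial
    by (intro exI[of _ "\<lambda>x h. (bump (k + 2) (1 - c * (x \<bullet> x)) - k * bump (k + 1) (1 - c * (x \<bullet> x))) * (- 2 * c * (x \<bullet> h))"]) auto
next
  case (add f g)
  then obtain f' g' where "\<forall>x. (f has_derivative f' x) (at x)" "\<forall>b. bump_poly c (\<lambda>x. f' x b)"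
    "\<forall>x. (g has_derivative g' x) (at x)" "\<forall>b. bump_poly c (\<lambda>x. g' x b)" by blast
  then show ?case
    by (intro exI[of _ "\<lambda>x h. f' x h + g' x h"]) (auto intro: bump_poly.intros has_derivative_add)
next
  case (mult f g)
  then obtain f' g' where "\<forall>x. (f has_derivative f' x) (at x)" "\<forall>b. bump_poly c (\<lambda>x. f' x b)"
    "\<forall>x. (g has_derivative g' x) (at x)" "\<forall>b. bump_poly c (\<lambda>x. g' x b)" by blast
  then show ?case using mult.hyps
    by (intro exI[of _ "\<lambda>x h. f x * g' x h + f' x h * g x"] conjI allI bump_poly.add bump_poly.mult)
       (auto intro: has_derivative_mult)
qed

text \<open>\<open>bump_poly c\<close> is itself the coinduction invariant: each partial derivative
  of a member is again a member.\<close>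

lemma smooth_bump_poly: "bump_poly c f \<Longrightarrow> smooth f"
proof (coinduction arbitrary: f)
  case smooth
  then obtain f' where f': "\<And>x. (f has_derivative f' x) (at x)" "\<And>b. bump_poly c (\<lambda>x. f' x b)"
    using bump_poly_derivative by blast
  then have "frechet_derivative f (at x) = f' x" for x
    using frechet_derivative_at by metis
  then show ?case using f' unfolding differentiable_def by auto
qed

lemma grad_eqI:
  assumes "(f has_derivative (\<lambda>h. G \<bullet> h)) (at x)"
  shows "grad f x = G"
  using frechet_derivative_at[OF assms, symmetric] by (simp add: grad_def euclidean_representation)

section \<open>The square of a coordinate as extremal function\<close>

context gaussian begin

context
  fixes b :: "'a::euclidean_space"
  assumes b: "b \<in> Basis"
begin

lemma has_integral_inner_fourth:
  "has_bochner_integral (gauss_mu lam) (\<lambda>x. (x \<bullet> b) ^ 4) (3 * lam ^ 4)"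
  using has_integral_gauss_mu_even[OF b, of 2] 
  by (simp add: fact_numeral field_simps power2_eq_square power4_eq_xxxx)

lemma has_integral_inner_second:
  "has_bochner_integral (gauss_mu lam) (\<lambda>x. (x \<bullet> b)\<^sup>2) (lam\<^sup>2)"
  using has_integral_gauss_mu_even[OF b, of 1] 
  by (simp add: fact_numeral)

text \<open>The extremal (x.b)^2, which has Hermite components of degrees 0 and 2 only, times a
  smooth cutoff that vanishes outside the ball of radius n + 1 and tends to 1 pointwise.\<close>

definition quad_approx :: "nat \<Rightarrow> 'a \<Rightarrow> real" where
  "quad_approx n x = (x \<bullet> b)\<^sup>2 * (exp 1 * bump 0 (1 - (1 / (real n + 1))\<^sup>2 * (x \<bullet> x)))"

lemma test_fun_quad_approx: "test_fun (quad_approx n)"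
proof -
  define c where "c = (1 / (real n + 1))\<^sup>2"
  have c: "c > 0" by (simp add: c_def)
  have "bump_poly c (\<lambda>x::'a. ((x \<bullet> b) * (x \<bullet> b)) * (exp 1 * bump 0 (1 - c * (x \<bullet> x))))"
    by (intro bump_poly.intros)
  moreover have "quad_approx n = (\<lambda>x. ((x \<bullet> b) * (x \<bullet> b)) * (exp 1 * bump 0 (1 - c * (x \<bullet> x))))"
    by (simp add: fun_eq_iff quad_approx_def c_def power2_eq_square)
  ultimately have "smooth (quad_approx n)" using smooth_bump_poly by metis
  moreover have "bounded {x. quad_approx n x \<noteq> 0}"
  proof (rule bounded_subset[OF bounded_cball])
    show "{x. quad_approx n x \<noteq> 0} \<subseteq> cball 0 (sqrt (1 / c))"
    proof
      fix x assume "x \<in> {x. quad_approx n x \<noteq> 0}"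
      then have "1 - c * (x \<bullet> x) > 0" by (auto simp: quad_approx_def bump_def c_def split: if_splits)
      then have "(norm x)\<^sup>2 \<le> 1 / c" using c by (simp add: power2_norm_eq_inner field_simps)
      then show "x \<in> cball 0 (sqrt (1 / c))" by (simp add: real_le_rsqrt)
    qed
  qed
  ultimately show ?thesis by (simp add: test_fun_def)
qed

lemma grad_quad_approx:
  "grad (quad_approx n) x = (2 * (x \<bullet> b) * (exp 1 * bump 0 (1 - (1 / (real n + 1))\<^sup>2 * (x \<bullet> x)))) *\<^sub>R b
     - (2 * (1 / (real n + 1))\<^sup>2 * exp 1 * (x \<bullet> b)\<^sup>2 * bump 2 (1 - (1 / (real n + 1))\<^sup>2 * (x \<bullet> x))) *\<^sub>R x"
proof -
  define c where "c = (1 / (real n + 1))\<^sup>2"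
  have "(quad_approx n has_derivative (\<lambda>h. ((2 * (x \<bullet> b) * (exp 1 * bump 0 (1 - c * (x \<bullet> x)))) *\<^sub>R b
     - (2 * c * exp 1 * (x \<bullet> b)\<^sup>2 * bump 2 (1 - c * (x \<bullet> x))) *\<^sub>R x) \<bullet> h)) (at x)"
    unfolding quad_approx_def[abs_def] c_def[symmetric]
    by (rule derivative_eq_intros has_derivative_bump_radial refl)+
       (simp add: fun_eq_iff inner_diff_left inner_commute power2_eq_square algebra_simps, simp add: numeral_2_eq_2)
  then show ?thesis unfolding c_def by (rule grad_eqI)
qed

lemma quad_approx_cutoff_tendsto:
  "(\<lambda>n. exp 1 * bump 0 (1 - (1 / (real n + 1))\<^sup>2 * ((x::'a) \<bullet> x))) \<longlonglongrightarrow> 1"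
proof -
  have e: "(\<lambda>n. 1 / (real n + 1)) \<longlonglongrightarrow> 0" 
    using LIMSEQ_ignore_initial_segment[OF lim_1_over_n[where 'a=real], of 1] by (simp add: add.commute)
  have "(\<lambda>n. 1 - (1 / (real n + 1))\<^sup>2 * (x \<bullet> x)) \<longlonglongrightarrow> 1 - 0\<^sup>2 * (x \<bullet> x)"
    by (intro tendsto_intros e)
  moreover have "isCont (bump 0) 1" using DERIV_bump DERIV_isCont by blast
  ultimately have "(\<lambda>n. bump 0 (1 - (1 / (real n + 1))\<^sup>2 * (x \<bullet> x))) \<longlonglongrightarrow> bump 0 1"
    by (intro isCont_tendsto_compose[of _ "bump 0"]) auto
  then have "(\<lambda>n. exp 1 * bump 0 (1 - (1 / (real n + 1))\<^sup>2 * (x \<bullet> x))) \<longlonglongrightarrow> exp 1 * bump 0 1"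
    by (intro tendsto_intros)
  then show ?thesis by (simp add: bump_def exp_minus)
qed

text \<open>The gradient error consists of (1 - cutoff) times the gradient and of a term from the
  derivative of the cutoff, of size (x.b)^2 / (n + 1) up to a constant. The finite second and fourth
  moments dominate its square.\<close>

lemma X_lam0_quadratic: "X_lam0 lam (\<lambda>x. (x \<bullet> b)\<^sup>2) (\<lambda>x. (2 * (x \<bullet> b)) *\<^sub>R b)"
  unfolding X_lam0_def
proof (intro conjI exI[of _ quad_approx] allI test_fun_quad_approx)
  define cut where "cut n x = exp 1 * bump 0 (1 - (1 / (real n + 1))\<^sup>2 * (x \<bullet> x))" for n :: nat and x :: 'a
  have cut: "0 \<le> cut n x" "cut n x \<le> 1" for n x by (auto simp: cut_def bump_0_le)
  have cut2: "(1 - cut n x)\<^sup>2 \<le> 1" for n x using cut[of n x] by (simp add: abs_square_le_1)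
  have cutlim: "(\<lambda>n. cut n x) \<longlonglongrightarrow> 1" for x unfolding cut_def by (rule quad_approx_cutoff_tendsto)
  have [measurable]: "cut n \<in> borel_measurable borel" for n unfolding cut_def by measurable
  have fin4: "(\<integral>\<^sup>+ x. ennreal (C * (x \<bullet> b)\<^sup>2 + D * (x \<bullet> b) ^ 4) \<partial>gauss_mu lam) < \<infinity>"
    if "C \<ge> 0" "D \<ge> 0" for C D
    using has_integral_inner_fourth has_integral_inner_second that
    by (subst nn_integral_eq_integral) (auto simp: has_bochner_integral_iff)
  have "(\<lambda>n. \<integral>\<^sup>+ x. ennreal ((quad_approx n x - (x \<bullet> b)\<^sup>2)\<^sup>2) \<partial>gauss_mu lam) \<longlonglongrightarrow> (\<integral>\<^sup>+ x. 0 \<partial>(gauss_mu lam :: 'a measure))"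
  proof (rule nn_integral_dominated_convergence[OF _ _ _ _ fin4[of 0 1]])
    have eq: "(quad_approx n x - (x \<bullet> b)\<^sup>2)\<^sup>2 = (x \<bullet> b) ^ 4 * (1 - cut n x)\<^sup>2" for n x
      unfolding quad_approx_def cut_def[symmetric] by (simp add: power2_eq_square power4_eq_xxxx algebra_simps)
    show "(\<lambda>x. ennreal ((quad_approx n x - (x \<bullet> b)\<^sup>2)\<^sup>2)) \<in> borel_measurable (gauss_mu lam)" for n
      unfolding eq by measurable
    show "AE x in gauss_mu lam. ennreal ((quad_approx n x - (x \<bullet> b)\<^sup>2)\<^sup>2) \<le> ennreal (0 * (x \<bullet> b)\<^sup>2 + 1 * (x \<bullet> b) ^ 4)" for n
      unfolding eq using cut2 by (intro AE_I2 ennreal_leI) (simp add: mult_left_le)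
    show "AE x in gauss_mu lam. (\<lambda>n. ennreal ((quad_approx n x - (x \<bullet> b)\<^sup>2)\<^sup>2)) \<longlonglongrightarrow> 0"
    proof (intro AE_I2)
      fix x
      have "(\<lambda>n. (x \<bullet> b) ^ 4 * (1 - cut n x)\<^sup>2) \<longlonglongrightarrow> (x \<bullet> b) ^ 4 * (1 - 1)\<^sup>2"
        by (intro tendsto_intros cutlim)
      from tendsto_ennrealI[OF this] show "(\<lambda>n. ennreal ((quad_approx n x - (x \<bullet> b)\<^sup>2)\<^sup>2)) \<longlonglongrightarrow> 0"
        unfolding eq by simp
    qed
  qed auto
  then show "(\<lambda>n. \<integral>\<^sup>+ x. ennreal ((quad_approx n x - (x \<bullet> b)\<^sup>2)\<^sup>2) \<partial>gauss_mu lam) \<longlonglongrightarrow> 0" by simp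
  \<comment> \<open>From (a + b)^2 <= 2 a^2 + 2 b^2 with a = 2 |x.b| (1 - cutoff) and b = 4 exp(1)
    (x.b)^2 / (n + 1): the constants are 2 * 4 and 2 * 16.\<close>
  define K where "K n x = 8 * (x \<bullet> b)\<^sup>2 * (1 - cut n x)\<^sup>2 + 32 * (exp 1)\<^sup>2 * (1 / (real n + 1))\<^sup>2 * (x \<bullet> b) ^ 4" for n and x :: 'a
  have bound: "(norm (grad (quad_approx n) x - (2 * (x \<bullet> b)) *\<^sub>R b))\<^sup>2 \<le> K n x" for n x
  proof -
    define d where "d = 1 / (real n + 1)"
    have d: "d > 0" by (simp add: d_def)
    define v where "v = (2 * d\<^sup>2 * exp 1 * (x \<bullet> b)\<^sup>2 * bump 2 (1 - d\<^sup>2 * (x \<bullet> x))) *\<^sub>R x"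
    \<comment> \<open>One power of d is spent on |x|: wherever the cutoff derivative is nonzero, d
      |x| <= 1 and so d^2 |x| <= d. The other factor 2 is the bound on
      \<open>bump 2\<close>.\<close>
    have v: "norm v \<le> 4 * exp 1 * d * (x \<bullet> b)\<^sup>2"
    proof (cases "1 - d\<^sup>2 * (x \<bullet> x) > 0")
      case True
      then have "(d * norm x)\<^sup>2 \<le> 1" by (simp add: power_mult_distrib power2_norm_eq_inner)
      then have dx: "d * norm x \<le> 1" using d by (simp add: abs_square_le_1)
      have "norm v = (2 * exp 1 * d * (x \<bullet> b)\<^sup>2) * (bump 2 (1 - d\<^sup>2 * (x \<bullet> x)) * (d * norm x))"
        using d by (simp add: v_def abs_mult power2_eq_square mult_ac)
      also have "\<dots> \<le> (2 * exp 1 * d * (x \<bullet> b)\<^sup>2) * (2 * 1)"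
        using d dx bump_2_le by (intro mult_left_mono mult_mono) auto
      finally show ?thesis by simp
    next
      case False
      then show ?thesis using d by (simp add: v_def bump_def)
    qed
    have "grad (quad_approx n) x - (2 * (x \<bullet> b)) *\<^sub>R b = - ((2 * (x \<bullet> b) * (1 - cut n x)) *\<^sub>R b + v)"
      unfolding grad_quad_approx v_def cut_def d_def by (simp add: algebra_simps)
    then have "norm (grad (quad_approx n) x - (2 * (x \<bullet> b)) *\<^sub>R b) \<le> norm ((2 * (x \<bullet> b) * (1 - cut n x)) *\<^sub>R b) + norm v"
      by (simp only: norm_minus_cancel norm_triangle_ineq)
    also have "\<dots> \<le> \<bar>2 * (x \<bullet> b) * (1 - cut n x)\<bar> + 4 * exp 1 * d * (x \<bullet> b)\<^sup>2"
      using v b by simp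
    finally have "(norm (grad (quad_approx n) x - (2 * (x \<bullet> b)) *\<^sub>R b))\<^sup>2
        \<le> (\<bar>2 * (x \<bullet> b) * (1 - cut n x)\<bar> + 4 * exp 1 * d * (x \<bullet> b)\<^sup>2)\<^sup>2"
      by (intro power_mono) auto
    also have "\<dots> \<le> 2 * \<bar>2 * (x \<bullet> b) * (1 - cut n x)\<bar>\<^sup>2 + 2 * (4 * exp 1 * d * (x \<bullet> b)\<^sup>2)\<^sup>2"
      using sum_squares_bound[of "\<bar>2 * (x \<bullet> b) * (1 - cut n x)\<bar>" "4 * exp 1 * d * (x \<bullet> b)\<^sup>2"] by (simp add: power2_sum)
    also have "\<dots> = K n x"
      by (simp add: K_def d_def power_mult_distrib power_divide flip: power_mult)
    finally show ?thesis .
  qed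
  have "(\<lambda>n. \<integral>\<^sup>+ x. ennreal ((norm (grad (quad_approx n) x - (2 * (x \<bullet> b)) *\<^sub>R b))\<^sup>2) \<partial>gauss_mu lam) \<longlonglongrightarrow> (\<integral>\<^sup>+ x. 0 \<partial>(gauss_mu lam :: 'a measure))"
  proof (rule nn_integral_dominated_convergence[OF _ _ _ _ fin4[of 8 "32 * (exp 1)\<^sup>2"]])
    show "(\<lambda>x. ennreal ((norm (grad (quad_approx n) x - (2 * (x \<bullet> b)) *\<^sub>R b))\<^sup>2)) \<in> borel_measurable (gauss_mu lam)" for n
      unfolding grad_quad_approx by measurable
    show "AE x in gauss_mu lam. ennreal ((norm (grad (quad_approx n) x - (2 * (x \<bullet> b)) *\<^sub>R b))\<^sup>2)
         \<le> ennreal (8 * (x \<bullet> b)\<^sup>2 + 32 * (exp 1)\<^sup>2 * (x \<bullet> b) ^ 4)" for n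
    proof (intro AE_I2 ennreal_leI)
      fix x
      have d: "(1 / (real n + 1))\<^sup>2 \<le> 1" by (simp add: abs_square_le_1)
      have "K n x \<le> 8 * (x \<bullet> b)\<^sup>2 * 1 + 32 * (exp 1)\<^sup>2 * 1 * (x \<bullet> b) ^ 4"
        unfolding K_def using cut2 d by (intro add_mono mult_left_mono mult_right_mono) auto
      then show "(norm (grad (quad_approx n) x - (2 * (x \<bullet> b)) *\<^sub>R b))\<^sup>2 \<le> 8 * (x \<bullet> b)\<^sup>2 + 32 * (exp 1)\<^sup>2 * (x \<bullet> b) ^ 4"
        using bound[of n x] by simp
    qed
    show "AE x in gauss_mu lam. (\<lambda>n. ennreal ((norm (grad (quad_approx n) x - (2 * (x \<bullet> b)) *\<^sub>R b))\<^sup>2)) \<longlonglongrightarrow> 0"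
    proof (intro AE_I2)
      fix x
      have e: "(\<lambda>n. 1 / (real n + 1)) \<longlonglongrightarrow> 0" 
        using LIMSEQ_ignore_initial_segment[OF lim_1_over_n[where 'a=real], of 1] by (simp add: add.commute)
      have "(\<lambda>n. K n x) \<longlonglongrightarrow> 8 * (x \<bullet> b)\<^sup>2 * (1 - 1)\<^sup>2 + 32 * (exp 1)\<^sup>2 * 0\<^sup>2 * (x \<bullet> b) ^ 4"
        unfolding K_def by (intro tendsto_intros cutlim e)
      from tendsto_ennrealI[OF this] have Klim: "(\<lambda>n. ennreal (K n x)) \<longlonglongrightarrow> 0" by simp
      show "(\<lambda>n. ennreal ((norm (grad (quad_approx n) x - (2 * (x \<bullet> b)) *\<^sub>R b))\<^sup>2)) \<longlonglongrightarrow> 0"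
        by (rule tendsto_sandwich[OF _ _ tendsto_const Klim]) (auto intro!: always_eventually ennreal_leI bound)
    qed
  qed auto
  then show "(\<lambda>n. \<integral>\<^sup>+ x. ennreal ((norm (grad (quad_approx n) x - (2 * (x \<bullet> b)) *\<^sub>R b))\<^sup>2) \<partial>gauss_mu lam) \<longlonglongrightarrow> 0" by simp
qed measurable

lemma dirichlet_quadratic: "dirichlet lam (\<lambda>x. (2 * (x \<bullet> b)) *\<^sub>R b) = ennreal (4 * lam\<^sup>2)"
proof -
  have "(norm ((2 * (x \<bullet> b)) *\<^sub>R b))\<^sup>2 = 4 * (x \<bullet> b)\<^sup>2" for x
    using b by (simp add: power_mult_distrib)
  then show ?thesis
    unfolding dirichlet_def using has_integral_inner_second
    by (simp, subst nn_integral_eq_integral) (auto simp: has_bochner_integral_iff)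
qed

text \<open>The function (x.b)^2 has mean lam^2 and variance 3 lam^4 - lam^4 = 2 lam^4; any other
  constant c costs the additional (lam^2 - c)^2.\<close>

lemma quadratic_const_distance:
  "ennreal (2 * lam ^ 4) \<le> (\<integral>\<^sup>+ x. ennreal (((x \<bullet> b)\<^sup>2 - c)\<^sup>2) \<partial>gauss_mu lam)"
proof -
  interpret prob_space "gauss_mu lam :: 'a measure" by (rule prob_space_gauss_mu)
  have e: "((x \<bullet> b)\<^sup>2 - c)\<^sup>2 = (x \<bullet> b) ^ 4 - 2 * c * (x \<bullet> b)\<^sup>2 + c\<^sup>2" for x
    by (simp add: algebra_simps power4_eq_xxxx power2_eq_square)
  have "has_bochner_integral (gauss_mu lam) (\<lambda>x::'a. c\<^sup>2) (c\<^sup>2)"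
    using prob_space by (simp add: has_bochner_integral_iff)
  then have "has_bochner_integral (gauss_mu lam) (\<lambda>x. ((x \<bullet> b)\<^sup>2 - c)\<^sup>2) (3 * lam ^ 4 - 2 * c * lam\<^sup>2 + c\<^sup>2)"
    unfolding e using has_integral_inner_second has_integral_inner_fourth
    by (intro has_bochner_integral_add has_bochner_integral_diff has_bochner_integral_mult_right) auto
  then have "(\<integral>\<^sup>+ x. ennreal (((x \<bullet> b)\<^sup>2 - c)\<^sup>2) \<partial>gauss_mu lam) = ennreal (3 * lam ^ 4 - 2 * c * lam\<^sup>2 + c\<^sup>2)"
    by (subst nn_integral_eq_integral) (auto simp: has_bochner_integral_iff)
  also have "\<dots> \<ge> ennreal (2 * lam ^ 4)"
  proof (rule ennreal_leI)
    have "0 \<le> (lam\<^sup>2 - c)\<^sup>2" by simp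
    then show "2 * lam ^ 4 \<le> 3 * lam ^ 4 - 2 * c * lam\<^sup>2 + c\<^sup>2"
      by (simp add: power2_diff mult_ac flip: power_mult)
  qed
  finally show ?thesis .
qed

text \<open>Averaging over \<open>x\<close> and \<open>- x\<close> removes the linear term.\<close>
lemma quadratic_affine_distance:
  "(\<integral>\<^sup>+ x. ennreal (((x \<bullet> b)\<^sup>2 - c)\<^sup>2) \<partial>gauss_mu lam) \<le> (\<integral>\<^sup>+ x. ennreal (((x \<bullet> b)\<^sup>2 - c - d \<bullet> x)\<^sup>2) \<partial>gauss_mu lam)"
  (is "?P \<le> ?Q")
proof -
  have "?Q = (\<integral>\<^sup>+ x. ennreal (((x \<bullet> b)\<^sup>2 - c - d \<bullet> x)\<^sup>2) \<partial>distr (gauss_mu lam) borel uminus)"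
    unfolding distr_gauss_mu_uminus ..
  also have "\<dots> = (\<integral>\<^sup>+ x. ennreal (((x \<bullet> b)\<^sup>2 - c + d \<bullet> x)\<^sup>2) \<partial>gauss_mu lam)"
    by (subst nn_integral_distr) auto
  finally have "2 * ?Q = (\<integral>\<^sup>+ x. ennreal (((x \<bullet> b)\<^sup>2 - c - d \<bullet> x)\<^sup>2) + ennreal (((x \<bullet> b)\<^sup>2 - c + d \<bullet> x)\<^sup>2) \<partial>gauss_mu lam)"
    by (subst nn_integral_add) (auto simp: mult_2)
  also have "\<dots> \<ge> (\<integral>\<^sup>+ x. 2 * ennreal (((x \<bullet> b)\<^sup>2 - c)\<^sup>2) \<partial>gauss_mu lam)"
  proof (rule nn_integral_mono)
    fix x
    define w where "w = (x \<bullet> b)\<^sup>2 - c"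
    have "2 * w\<^sup>2 \<le> (w - d \<bullet> x)\<^sup>2 + (w + d \<bullet> x)\<^sup>2" by (simp add: power2_diff power2_sum)
    then have "ennreal (2 * w\<^sup>2) \<le> ennreal ((w - d \<bullet> x)\<^sup>2 + (w + d \<bullet> x)\<^sup>2)" by (rule ennreal_leI)
    then show "2 * ennreal (((x \<bullet> b)\<^sup>2 - c)\<^sup>2) \<le> ennreal (((x \<bullet> b)\<^sup>2 - c - d \<bullet> x)\<^sup>2) + ennreal (((x \<bullet> b)\<^sup>2 - c + d \<bullet> x)\<^sup>2)"
      by (simp add: w_def ennreal_mult)
  qed
  also have "(\<integral>\<^sup>+ x. 2 * ennreal (((x \<bullet> b)\<^sup>2 - c)\<^sup>2) \<partial>gauss_mu lam) = 2 * ?P"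
    by (subst nn_integral_cmult) auto
  finally show ?thesis by (simp add: ennreal_mult_le_mult_iff)
qed

text \<open>Both terms of the integrand contribute at least 2 lam^4, and 4 lam^4 / lam^2 is the
  Dirichlet integral 4 lam^2. The reverse bound is an instance of the general inequality.\<close>

lemma rhs_inf_quadratic: "ennreal (4 * lam\<^sup>2) \<le> rhs_inf lam (\<lambda>x. (x \<bullet> b)\<^sup>2)"
proof -
  have "ennreal (4 * lam ^ 4) \<le> (\<integral>\<^sup>+ x. ennreal (((x \<bullet> b)\<^sup>2 - c)\<^sup>2 + ((x \<bullet> b)\<^sup>2 - c - d \<bullet> x)\<^sup>2) \<partial>gauss_mu lam)" for c d
  proof -
    have "ennreal (4 * lam ^ 4) = ennreal (2 * lam ^ 4) + ennreal (2 * lam ^ 4)"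
      by (simp flip: ennreal_plus)
    also have "\<dots> \<le> (\<integral>\<^sup>+ x. ennreal (((x \<bullet> b)\<^sup>2 - c)\<^sup>2) \<partial>gauss_mu lam) + (\<integral>\<^sup>+ x. ennreal (((x \<bullet> b)\<^sup>2 - c - d \<bullet> x)\<^sup>2) \<partial>gauss_mu lam)"
      using quadratic_const_distance quadratic_affine_distance order_trans by (intro add_mono) blast+
    also have "\<dots> = (\<integral>\<^sup>+ x. ennreal (((x \<bullet> b)\<^sup>2 - c)\<^sup>2 + ((x \<bullet> b)\<^sup>2 - c - d \<bullet> x)\<^sup>2) \<partial>gauss_mu lam)"
      by (subst nn_integral_add[symmetric]) auto
    finally show ?thesis .
  qed
  then have "ennreal (1 / lam\<^sup>2) * ennreal (4 * lam ^ 4) \<le> rhs_inf lam (\<lambda>x. (x \<bullet> b)\<^sup>2)"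
    unfolding rhs_inf_def by (intro mult_left_mono INF_greatest) auto
  moreover have "ennreal (1 / lam\<^sup>2) * ennreal (4 * lam ^ 4) = ennreal (4 * lam\<^sup>2)"
    using lam by (simp add: power2_eq_square power4_eq_xxxx flip: ennreal_mult)
  ultimately show ?thesis by simp
qed

text \<open>Agreement with an affine function, even almost everywhere, would make the squared
  distance zero, against its lower bound 2 lam^4.\<close>

lemma quadratic_not_affine: "\<not> (AE x in gauss_mu lam. (x \<bullet> b)\<^sup>2 = c + d \<bullet> x)"
proof
  assume "AE x in gauss_mu lam. (x \<bullet> b)\<^sup>2 = c + d \<bullet> x"
  then have "AE x in gauss_mu lam. ennreal (((x \<bullet> b)\<^sup>2 - c - d \<bullet> x)\<^sup>2) = 0" by eventually_elim simp
  then have "(\<integral>\<^sup>+ x. ennreal (((x \<bullet> b)\<^sup>2 - c - d \<bullet> x)\<^sup>2) \<partial>gauss_mu lam) = 0"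
    by (subst nn_integral_0_iff_AE) auto
  then have "ennreal (2 * lam ^ 4) \<le> 0"
    using quadratic_const_distance[of c] quadratic_affine_distance[of c d] by simp
  then show False using lam by (simp add: ennreal_eq_0_iff)
qed

end
end

theorem theorem1p9:
  fixes lam :: real
  assumes "lam > 0"
  shows "(\<forall>(u :: 'a::euclidean_space \<Rightarrow> real) g. X_lam0 lam u g \<longrightarrow>
            dirichlet lam g \<ge> rhs_inf lam u)
       \<and> (\<exists>(u :: 'a \<Rightarrow> real) g. X_lam0 lam u g
            \<and> \<not> (\<exists>c d. AE x in gauss_mu lam. u x = c + d \<bullet> x)
            \<and> dirichlet lam g = rhs_inf lam u)"
proof -
  interpret gaussian lam by unfold_locales (rule assms)
  obtain b :: 'a where b: "b \<in> Basis" using nonempty_Basis by blast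
  let ?u = "\<lambda>x::'a. (x \<bullet> b)\<^sup>2" and ?g = "\<lambda>x::'a. (2 * (x \<bullet> b)) *\<^sub>R b"
  have X: "X_lam0 lam ?u ?g" by (rule X_lam0_quadratic[OF b])
  have "dirichlet lam ?g = rhs_inf lam ?u"
    using rhs_inf_quadratic[OF b] rhs_inf_le_dirichlet[OF X] dirichlet_quadratic[OF b] by (intro antisym) auto
  moreover have "\<not> (\<exists>c d. AE x in gauss_mu lam. ?u x = c + d \<bullet> x)"
    using quadratic_not_affine[OF b] by blast
  ultimately show ?thesis using X rhs_inf_le_dirichlet by blast
qed

end
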